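(* Let $K\subset\mathbb{C}$ be a compact convex set having width $w>0$ and diameter $d$. Let $0<q\le\infty$, and let $n$ be a positive integer with $n\ge 2\left(1+\frac1q\right)\frac{d^2}{w^2}\ln\frac{d}{w}$ (where $1/q:=0$ for $q=\infty$). If $\mu$ is the linear Lebesgue measure (arc length measure) on the boundary of $K$, then $$M_{n,q}(K,\mu)\le C_q\,\frac{w}{d^2}\,n,$$ where $$C_q:=121\,\frac{3q+2+2\sqrt{q^2+3q+1}}{5q}\left(3+2q+2\sqrt{q^2+3q+1}\right)^{1/q}$$ for $0<q<\infty$, and $C_\infty:=\lim_{q\to\infty}C_q=121$.
   Context: For a compact set $K\subset\mathbb{C}$: the diameter is $d=d(K):=\max_{z,z'\in K}|z-z'|$, and the width is $w=w(K):=\min_{\gamma\in[-\pi,\pi]}\max_{z,z'\in K}\left(\operatorname{Re}(ze^{i\gamma})-\operatorname{Re}(z'e^{i\gamma})\right)$. For a finite Borel measure $\mu$ on $K$ and a polynomial $p\in\mathbb{C}[z]$: $\|p\|_q:=\left(\int_K|p(z)|^q\,\mu(dz)\right)^{1/q}$ for $0<q<\infty$, and $\|p\|_\infty:=\max_{z\in\operatorname{supp}\mu}|p(z)|$. $\mathcal{P}_n(K)$ denotes the set of polynomials with complex coefficients of degree exactly $n$ all of whose zeros lie in $K$, and $$M_{n,q}(K,\mu):=\inf\left\{\frac{\|p'\|_q}{\|p\|_q}:\ p\in\mathcal{P}_n(K),\ \|p\|_q\ne0\right\}.$$ *)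

theory Defs
  imports "HOL-Analysis.Analysis" "HOL-Computational_Algebra.Polynomial"
begin

text \<open>For a nonempty compact \<open>K\<close> the extrema below are attained; the diameter is the
  library's \<^const>\<open>diameter\<close>.\<close>

definition width :: "complex set \<Rightarrow> real" where
  "width K = (INF \<gamma>\<in>{-pi..pi}. SUP (z, z')\<in>K \<times> K.
     Re (z * exp (\<i> * of_real \<gamma>)) - Re (z' * exp (\<i> * of_real \<gamma>)))"

text \<open>The linear (one-dimensional Hausdorff) outer measure, normalised so that a segment gets its
  length. Boundedness of the covering sets is required because \<^const>\<open>diameter\<close> is
  meaningless on unbounded sets; covering sets may be empty.\<close>

definition linear_outer_measure :: "complex set \<Rightarrow> ennreal" where
  "linear_outer_measure A = (SUP \<delta>\<in>{0::real<..}.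
     INF X\<in>{X :: nat \<Rightarrow> complex set. A \<subseteq> (\<Union>i. X i) \<and> (\<forall>i. bounded (X i) \<and> diameter (X i) \<le> \<delta>)}.
       (\<Sum>i. ennreal (diameter (X i))))"

text \<open>Linear measure carried by \<open>B\<close>, as a Borel measure on the plane: \<open>A\<close> is mapped to the
  linear measure of \<open>A \<inter> B\<close>. On a rectifiable Jordan curve \<open>B\<close>, such as the boundary of a compact
  convex set with nonempty interior, this is the arc length measure.\<close>

definition linear_measure_on :: "complex set \<Rightarrow> complex measure" where
  "linear_measure_on B = measure_of UNIV (sets borel) (\<lambda>A. linear_outer_measure (A \<inter> B))"

definition measure_support :: "complex measure \<Rightarrow> complex set" where
  "measure_support \<mu> = {z. \<forall>U. open U \<longrightarrow> z \<in> U \<longrightarrow> emeasure \<mu> U > 0}"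

definition poly_norm :: "ennreal \<Rightarrow> complex set \<Rightarrow> complex measure \<Rightarrow> complex poly \<Rightarrow> real" where
  "poly_norm q K \<mu> p =
     (if q = \<infinity> then SUP z\<in>measure_support \<mu>. cmod (poly p z)
      else (LINT z:K|\<mu>. cmod (poly p z) powr enn2real q) powr (1 / enn2real q))"

definition polys_zeros_in :: "nat \<Rightarrow> complex set \<Rightarrow> complex poly set" where
  "polys_zeros_in n K = {p. p \<noteq> 0 \<and> degree p = n \<and> (\<forall>z. poly p z = 0 \<longrightarrow> z \<in> K)}"

text \<open>The infimum is taken in the extended reals, so it is \<open>\<infinity>\<close> if no polynomial is admissible.\<close>

definition turan_inf :: "nat \<Rightarrow> ennreal \<Rightarrow> complex set \<Rightarrow> complex measure \<Rightarrow> ereal" where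
  "turan_inf n q K \<mu> =
     (INF p\<in>{p \<in> polys_zeros_in n K. poly_norm q K \<mu> p \<noteq> 0}.
        ereal (poly_norm q K \<mu> (pderiv p) / poly_norm q K \<mu> p))"

definition turan_const_real :: "real \<Rightarrow> real" where
  "turan_const_real q =
     121 * ((3 * q + 2 + 2 * sqrt (q\<^sup>2 + 3 * q + 1)) / (5 * q))
         * (3 + 2 * q + 2 * sqrt (q\<^sup>2 + 3 * q + 1)) powr (1 / q)"

definition turan_const :: "ennreal \<Rightarrow> real" where
  "turan_const q = (if q = \<infinity> then Lim at_top turan_const_real else turan_const_real (enn2real q))"

end

theory Submission
  imports Defs "HOL-Real_Asymp.Real_Asymp"
begin

text \<open>Let \<open>a\<close>, \<open>b\<close> be end points of a diameter and \<open>p = (z - a)^k (z - b)^l\<close> with \<open>k + l = n\<close>,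
  \<open>k \<le> l \<le> k + 1\<close>. Normalise the chord to \<open>[-1, 1]\<close> by the coordinate \<open>\<zeta>\<close> and put \<open>W = 2 w / d\<close>;
  then \<open>|Im \<zeta>| \<le> sqrt 3 W\<close> on \<open>K\<close>, and \<open>p' / p\<close> is a multiple of
  \<open>(n \<zeta> + l - k) / (\<zeta>^2 - 1)\<close>. Off an exceptional part \<open>T\<close> of the boundary, the pointwise bound
  \<open>|p'| \<le> 121 n w / d^2 |p|\<close> holds. On \<open>T\<close> the derivative is dominated by the values of \<open>p\<close> on
  a part \<open>S\<close> of the boundary near the centre of the chord, in such a way that the contribution of \<open>T\<close> to the
  \<open>q\<close>-th power integral is at most four times what the pointwise bound would give; this costs the factor
  \<open>5 powr (1 / q)\<close>, which \<open>C\<^sub>q\<close> accommodates. If \<open>d \<ge> 8 w\<close>, \<open>T\<close> consists of the points with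
  \<open>|Re \<zeta>| > sqrt 12 W\<close>, where the lower bound for \<open>n\<close> makes \<open>p\<close> small; otherwise, \<open>T\<close> consists of
  neighbourhoods of the two zeros.\<close>

subsection \<open>Linear measure is a Borel measure\<close>

text \<open>Distinct rings whose indices have the same parity are at positive distance, so the
  values of \<open>f\<close> add up along each parity class to at most \<open>f X\<close>. The
  factor 2 counts the two classes.\<close>

lemma metric_outer_measure_ring_sum:
  fixes f :: "'a::metric_space set \<Rightarrow> ennreal"
  assumes empty: "f {} = 0" and mono: "\<And>A B. A \<subseteq> B \<Longrightarrow> f A \<le> f B"
    and sep: "\<And>A B e. 0 < e \<Longrightarrow> (\<And>x y. x \<in> A \<Longrightarrow> y \<in> B \<Longrightarrow> e \<le> dist x y) \<Longrightarrow> f A + f B \<le> f (A \<union> B)"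
    and RX: "\<And>i. R i \<subseteq> X"
    and R: "\<And>i j. i + 2 \<le> j \<Longrightarrow> \<exists>e>0. \<forall>x y. x \<in> R i \<longrightarrow> y \<in> R j \<longrightarrow> e \<le> dist x y"
  shows "(\<Sum>i. f (R i)) \<le> 2 * f X"
proof -
  have *: "(\<Sum>i<N. f (R (2 * i + p))) \<le> f (\<Union>i<N. R (2 * i + p))" for N p :: nat
  proof (induction N)
    case (Suc N)
    have "\<exists>e. \<forall>i<N. e i > (0::real) \<and> (\<forall>x y. x \<in> R (2*i+p) \<longrightarrow> y \<in> R (2*N+p) \<longrightarrow> e i \<le> dist x y)"
      by (rule choice) (use R in force)
    then obtain e where e: "\<And>i. i < N \<Longrightarrow> e i > (0::real)"
      "\<And>i x y. i < N \<Longrightarrow> x \<in> R (2*i+p) \<Longrightarrow> y \<in> R (2*N+p) \<Longrightarrow> e i \<le> dist x y"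
      by blast
    \<comment> \<open>The inserted 1 keeps the minimum meaningful for \<open>N = 0\<close>, where
      there is no earlier ring.\<close>
    define e' where "e' = Min (insert 1 (e ` {..<N}))"
    have "e' > 0" and e': "\<And>i. i < N \<Longrightarrow> e' \<le> e i"
      using e(1) by (auto simp: e'_def)
    have "f (\<Union>i<N. R (2 * i + p)) + f (R (2 * N + p)) \<le> f ((\<Union>i<N. R (2 * i + p)) \<union> R (2 * N + p))"
      using e(2) e' by (intro sep[OF \<open>e' > 0\<close>]) (force intro: order.trans)
    also have "(\<Union>i<N. R (2 * i + p)) \<union> R (2 * N + p) = (\<Union>i<Suc N. R (2 * i + p))"
      by (auto simp: less_Suc_eq)
    finally show ?case
      using Suc by (auto intro: order.trans[OF add_right_mono])
  qed (simp add: empty)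
  have "(\<Sum>i<N. f (R i)) \<le> 2 * f X" for N
  proof -
    have "(\<Sum>i<N. f (R i)) \<le> (\<Sum>i<2*N. f (R i))"
      by (rule sum_mono2) auto
    also have "\<dots> = (\<Sum>i<N. f (R (2 * i + 0))) + (\<Sum>i<N. f (R (2 * i + 1)))"
      by (induction N) (auto simp: algebra_simps)
    also have "\<dots> \<le> f X + f X"
      by (intro add_mono order.trans[OF *] mono) (use RX in auto)
    finally show ?thesis by (simp add: mult_2)
  qed
  then show ?thesis by (intro suminf_le_const summableI)
qed

text \<open>The predicate \<open>subadditive\<close> concerns disjoint sets, so \<open>B\<close> is
  replaced by \<open>B - A\<close>, and monotonicity restores \<open>B\<close>.\<close>

lemma outer_measure_space_Un:
  assumes "outer_measure_space (Pow UNIV) f"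
  shows "f (A \<union> B) \<le> f A + f B"
proof -
  interpret algebra UNIV "Pow (UNIV :: 'a set)" by (rule algebra_Pow)
  have "subadditive (Pow UNIV) f"
    using assms by (intro countably_subadditive_subadditive) (auto simp: outer_measure_space_def)
  then have "f (A \<union> (B - A)) \<le> f A + f (B - A)" unfolding subadditive_def by blast
  also have "f (B - A) \<le> f B"
    using assms by (auto simp: outer_measure_space_def increasing_def)
  finally show ?thesis by (simp add: add_left_mono)
qed

text \<open>Caratheodory's criterion: points of \<open>X - C\<close> close to \<open>C\<close> are collected in rings, and
  non-adjacent rings have positive distance, so the ring measures form a convergent series.\<close>
lemma metric_outer_measure_closed:
  fixes f :: "'a::metric_space set \<Rightarrow> ennreal"
  assumes om: "outer_measure_space (Pow UNIV) f"
    and sep: "\<And>A B e. 0 < e \<Longrightarrow> (\<And>x y. x \<in> A \<Longrightarrow> y \<in> B \<Longrightarrow> e \<le> dist x y) \<Longrightarrow> f A + f B \<le> f (A \<union> B)"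
    and "closed C"
  shows "C \<in> lambda_system UNIV (Pow UNIV) f"
proof -
  interpret algebra UNIV "Pow (UNIV :: 'a set)" by (rule algebra_Pow)
  have empty: "f {} = 0" and mono: "\<And>A B. A \<subseteq> B \<Longrightarrow> f A \<le> f B"
    and csub: "countably_subadditive (Pow UNIV) f"
    using om by (auto simp: outer_measure_space_def positive_def increasing_def)
  have sub: "f (A \<union> B) \<le> f A + f B" for A B
    by (rule outer_measure_space_Un[OF om])
  have csub': "f (\<Union>i. A i) \<le> (\<Sum>i. f (A i))" for A :: "nat \<Rightarrow> 'a set"
  proof -
    have "f (\<Union>i. disjointed A i) \<le> (\<Sum>i. f (disjointed A i))"
      using csub disjoint_family_disjointed[of A] unfolding countably_subadditive_def by auto
    also have "\<dots> \<le> (\<Sum>i. f (A i))"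
      by (intro suminf_le mono summableI disjointed_subset)
    finally show ?thesis by (simp add: UN_disjointed_eq)
  qed
  \<comment> \<open>Finiteness of \<open>f X\<close> makes the series of ring measures converge. The
    empty \<open>C\<close> is set apart because \<open>infdist x {}\<close> is 0.\<close>
  have main: "f (X \<inter> C) + f (X - C) \<le> f X" if fin: "f X < \<infinity>" and "C \<noteq> {}" for X
  proof (rule ennreal_le_epsilon)
    fix \<epsilon> :: real assume "\<epsilon> > 0"
    \<comment> \<open>\<open>E n\<close> consists of the points of \<open>X\<close> at distance at
      least \<open>1 / (n + 1)\<close> from \<open>C\<close>; the ring \<open>R n\<close> is what
      \<open>E (Suc n)\<close> adds to it.\<close>
    define E where "E n = {x \<in> X. inverse (real (Suc n)) \<le> infdist x C}" for n
    define R where "R n = E (Suc n) - E n" for n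
    have dist: "infdist x C - infdist y C \<le> dist x y" for x y
      using infdist_triangle[of x C y] by simp
    \<comment> \<open>Points of \<open>R i\<close> have distance at least \<open>1 / (i + 2)\<close>
      from \<open>C\<close>, points of \<open>R j\<close> less than \<open>1 / (j + 1)\<close>;
      \<open>i + 2 \<le> j\<close> makes the gap positive.\<close>
    have Rsep: "\<exists>e>0. \<forall>x y. x \<in> R i \<longrightarrow> y \<in> R j \<longrightarrow> e \<le> dist x y" if "i + 2 \<le> j" for i j
    proof (intro exI[of _ "inverse (real (i + 2)) - inverse (real (Suc j))"] conjI allI impI)
      show "0 < inverse (real (i + 2)) - inverse (real (Suc j))" using that by auto
      fix x y assume "x \<in> R i" "y \<in> R j"
      then have "inverse (real (i + 2)) \<le> infdist x C" "infdist y C \<le> inverse (real (Suc j))"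
        by (auto simp: R_def E_def)
      with dist[of x y] show "inverse (real (i + 2)) - inverse (real (Suc j)) \<le> dist x y" by simp
    qed
    have le: "(\<Sum>i. f (R i)) \<le> 2 * f X"
      by (rule metric_outer_measure_ring_sum[OF empty mono sep _ Rsep]) (auto simp: R_def E_def)
    then have finR: "(\<Sum>i. f (R i)) < \<infinity>" 
      by (rule order.strict_trans1) (use fin in \<open>simp add: ennreal_mult_less_top\<close>)
    define r where "r i = enn2real (f (R i))" for i
    have r0: "0 \<le> r i" for i by (simp add: r_def)
    have r: "f (R i) = ennreal (r i)" for i
    proof -
      have "f (R i) < \<infinity>" by (rule order.strict_trans1[OF mono fin]) (auto simp: R_def E_def)
      then show ?thesis by (simp add: r_def)
    qed
    have "summable r"
      using finR by (intro summable_suminf_not_top r0) (simp flip: r)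
    from suminf_exist_split[OF \<open>\<epsilon> > 0\<close> this] obtain N where N: "norm (\<Sum>i. r (i + N)) < \<epsilon>" by auto
    have tail: "(\<Sum>i. f (R (i + N))) \<le> ennreal \<epsilon>"
    proof -
      have "summable (\<lambda>i. r (i + N))" using \<open>summable r\<close> by (simp add: summable_iff_shift)
      then have "(\<Sum>i. f (R (i + N))) = ennreal (\<Sum>i. r (i + N))"
        unfolding r by (intro suminf_ennreal_eq r0) (simp add: summable_sums)
      also have "\<dots> \<le> ennreal \<epsilon>" using N by (intro ennreal_leI) auto
      finally show ?thesis .
    qed
    have Em: "\<exists>m. x \<in> E m" if "x \<in> X - C" for x
    proof -
      have "infdist x C > 0"
        using that \<open>closed C\<close> \<open>C \<noteq> {}\<close> by (metis DiffD2 in_closed_iff_infdist_zero infdist_nonneg less_eq_real_def)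
      from reals_Archimedean[OF this] show ?thesis using that by (auto simp: E_def intro: less_imp_le)
    qed
    \<comment> \<open>If the least index \<open>m\<close> with \<open>x \<in> E m\<close> exceeds
      \<open>N\<close>, then \<open>x\<close> lies in the ring with index
      \<open>m - 1\<close>.\<close>
    have "X - C \<subseteq> E N \<union> (\<Union>i. R (i + N))"
    proof
      fix x assume "x \<in> X - C"
      from Em[OF this] have "\<exists>m. x \<in> E m" .
      then have L: "x \<in> E (LEAST m. x \<in> E m)" by (rule LeastI_ex)
      show "x \<in> E N \<union> (\<Union>i. R (i + N))"
      proof (cases "(LEAST m. x \<in> E m) \<le> N")
        case True
        then have "inverse (real (Suc N)) \<le> inverse (real (Suc (LEAST m. x \<in> E m)))" by auto
        moreover have "x \<in> X" "inverse (real (Suc (LEAST m. x \<in> E m))) \<le> infdist x C"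
          using L unfolding E_def by auto
        ultimately have "x \<in> E N" unfolding E_def by (simp only: mem_Collect_eq) (blast intro: order.trans)
        then show ?thesis ..
      next
        case False
        define m where "m = (LEAST m. x \<in> E m) - 1"
        have m: "(LEAST m. x \<in> E m) = Suc m" and "N \<le> m" using False by (auto simp: m_def)
        have "x \<notin> E m" using not_less_Least[of m "\<lambda>m. x \<in> E m"] m by auto
        then have "x \<in> R ((m - N) + N)" using L m \<open>N \<le> m\<close> by (simp add: R_def)
        then show ?thesis by blast
      qed
    qed
    then have "f (X - C) \<le> f (E N) + (\<Sum>i. f (R (i + N)))"
      by (intro order.trans[OF mono order.trans[OF sub add_left_mono[OF csub']]]) 
    also have "\<dots> \<le> f (E N) + ennreal \<epsilon>" by (intro add_left_mono tail)
    finally have "f (X \<inter> C) + f (X - C) \<le> f (X \<inter> C) + f (E N) + ennreal \<epsilon>"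
      by (simp add: add_left_mono add.assoc)
    also have "f (X \<inter> C) + f (E N) \<le> f (X \<inter> C \<union> E N)"
    proof (rule sep)
      fix x y assume "x \<in> X \<inter> C" "y \<in> E N"
      then show "inverse (real (Suc N)) \<le> dist x y"
        using infdist_le[of x C y] by (auto simp: E_def dist_commute)
    qed simp
    also have "\<dots> \<le> f X" by (intro mono) (auto simp: E_def)
    finally show "f (X \<inter> C) + f (X - C) \<le> f X + ennreal \<epsilon>" by (simp add: add_right_mono)
  qed
  have "f (X \<inter> C) + f (X - C) = f X" for X
  proof (cases "f X < \<infinity> \<and> C \<noteq> {}")
    case True
    then show ?thesis
      using main[of X] sub[of "X \<inter> C" "X - C"] by (simp add: Int_Diff_Un antisym)
  next
    \<comment> \<open>Here \<open>f X\<close> is infinite or \<open>C\<close> is empty, and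
      subadditivity with \<open>f {} = 0\<close> is enough.\<close>
    case False
    then show ?thesis
      using sub[of "X \<inter> C" "X - C"] by (auto simp: Int_Diff_Un empty less_top[symmetric] top_unique)
  qed
  then show ?thesis unfolding lambda_system_eq by blast
qed

section \<open>Hausdorff premeasures at a fixed scale and the linear outer measure\<close>

definition linear_premeasure :: "real \<Rightarrow> complex set \<Rightarrow> ennreal" where
  "linear_premeasure \<delta> A =
     (INF X\<in>{X :: nat \<Rightarrow> complex set. A \<subseteq> (\<Union>i. X i) \<and> (\<forall>i. bounded (X i) \<and> diameter (X i) \<le> \<delta>)}.
       (\<Sum>i. ennreal (diameter (X i))))"

lemma linear_outer_measure_eq: "linear_outer_measure A = (SUP \<delta>\<in>{0<..}. linear_premeasure \<delta> A)"
  by (simp add: linear_outer_measure_def linear_premeasure_def)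

lemma linear_premeasure_le:
  "A \<subseteq> (\<Union>i. X i) \<Longrightarrow> (\<And>i. bounded (X i)) \<Longrightarrow> (\<And>i. diameter (X i) \<le> \<delta>) \<Longrightarrow>
    linear_premeasure \<delta> A \<le> (\<Sum>i. ennreal (diameter (X i)))"
  unfolding linear_premeasure_def by (intro INF_lower) auto

lemma linear_premeasure_cover:
  assumes "linear_premeasure \<delta> A < c"
  obtains X where "A \<subseteq> (\<Union>i. X i)" "\<And>i::nat. bounded (X i)" "\<And>i. diameter (X i) \<le> \<delta>"
    "(\<Sum>i. ennreal (diameter (X i))) < c"
  using assms unfolding linear_premeasure_def INF_less_iff by auto

lemma linear_premeasure_mono: "A \<subseteq> B \<Longrightarrow> linear_premeasure \<delta> A \<le> linear_premeasure \<delta> B"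
  unfolding linear_premeasure_def by (intro INF_superset_mono) auto

lemma linear_premeasure_antimono: "\<delta> \<le> \<delta>' \<Longrightarrow> linear_premeasure \<delta>' A \<le> linear_premeasure \<delta> A"
  unfolding linear_premeasure_def by (intro INF_superset_mono) (auto intro: order.trans)

text \<open>Covers of the sets \<open>A n\<close> that are optimal up to
  \<open>e / 2 ^ (n + 1)\<close> are enumerated by \<open>prod_decode\<close> as one cover of the
  union; the errors add up to \<open>e\<close>.\<close>

lemma linear_premeasure_UN:
  fixes A :: "nat \<Rightarrow> complex set"
  shows "linear_premeasure \<delta> (\<Union>n. A n) \<le> (\<Sum>n. linear_premeasure \<delta> (A n))"
proof (rule ennreal_le_epsilon)
  fix e :: real assume "0 < e" "(\<Sum>n. linear_premeasure \<delta> (A n)) < top"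
  then have *: "\<And>n. linear_premeasure \<delta> (A n) < linear_premeasure \<delta> (A n) + e * (1/2)^Suc n"
    by (auto simp add: less_top dest!: ennreal_suminf_lessD)
  have "\<forall>n. \<exists>X :: nat \<Rightarrow> complex set. A n \<subseteq> (\<Union>i. X i) \<and> (\<forall>i. bounded (X i) \<and> diameter (X i) \<le> \<delta>) \<and>
     (\<Sum>i. ennreal (diameter (X i))) \<le> linear_premeasure \<delta> (A n) + e * (1/2)^Suc n"
    by (metis linear_premeasure_cover[OF *] less_imp_le)
  then obtain B :: "nat \<Rightarrow> nat \<Rightarrow> complex set" where
      sbB: "\<And>n. A n \<subseteq> (\<Union>i. B n i)" and bB: "\<And>n i. bounded (B n i)" "\<And>n i. diameter (B n i) \<le> \<delta>"
      and Ble: "\<And>n. (\<Sum>i. ennreal (diameter (B n i))) \<le> linear_premeasure \<delta> (A n) + e * (1/2)^(Suc n)"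
    by metis
  define C where "C = case_prod B \<circ> prod_decode"
  have "(\<Union>i. A i) \<subseteq> (\<Union>i. C i)"
    using sbB by (auto simp add: C_def subset_eq) (metis prod.case prod_encode_inverse)
  then have "linear_premeasure \<delta> (\<Union>i. A i) \<le> (\<Sum>i. ennreal (diameter (C i)))"
    by (intro linear_premeasure_le) (auto simp: C_def bB split: prod.split)
  also have "\<dots> = (\<Sum>n. \<Sum>i. ennreal (diameter (B n i)))"
    unfolding C_def comp_def by (intro suminf_ennreal_2dimen) auto
  also have "\<dots> \<le> (\<Sum>n. linear_premeasure \<delta> (A n) + e * (1/2) ^ Suc n)"
    by (intro suminf_le summableI Ble)
  also have "... = (\<Sum>n. linear_premeasure \<delta> (A n)) + (\<Sum>n. ennreal e * ennreal ((1/2) ^ Suc n))"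
    using \<open>0 < e\<close> by (subst suminf_add[symmetric])
                     (auto simp del: ennreal_suminf_cmult simp add: ennreal_mult[symmetric])
  also have "\<dots> = (\<Sum>n. linear_premeasure \<delta> (A n)) + e"
    unfolding ennreal_suminf_cmult
    by (subst suminf_ennreal_eq[OF zero_le_power power_half_series]) auto
  finally show "linear_premeasure \<delta> (\<Union>i. A i) \<le> (\<Sum>n. linear_premeasure \<delta> (A n)) + e" .
qed

lemma linear_outer_measure_upper: "\<delta> > 0 \<Longrightarrow> linear_premeasure \<delta> A \<le> linear_outer_measure A"
  unfolding linear_outer_measure_eq by (intro SUP_upper) auto

lemma linear_outer_measure_mono: "A \<subseteq> B \<Longrightarrow> linear_outer_measure A \<le> linear_outer_measure B"
  unfolding linear_outer_measure_eq by (intro SUP_mono) (auto intro: linear_premeasure_mono)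

lemma linear_outer_measure_empty: "linear_outer_measure {} = 0"
proof -
  have "linear_premeasure \<delta> {} \<le> 0" if "\<delta> > 0" for \<delta>
    using linear_premeasure_le[of "{}" "\<lambda>_. {}" \<delta>] that by simp
  then have "linear_outer_measure {} \<le> 0" unfolding linear_outer_measure_eq by (intro SUP_least) auto
  then show ?thesis by simp
qed

lemma linear_outer_measure_UN:
  fixes A :: "nat \<Rightarrow> complex set"
  shows "linear_outer_measure (\<Union>n. A n) \<le> (\<Sum>n. linear_outer_measure (A n))"
  unfolding linear_outer_measure_eq[of "\<Union>n. A n"]
  by (intro SUP_least order.trans[OF linear_premeasure_UN] suminf_le summableI linear_outer_measure_upper) auto

lemma outer_measure_space_linear: "outer_measure_space (Pow UNIV) linear_outer_measure"
  by (auto simp: outer_measure_space_def positive_def increasing_def countably_subadditive_def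
      linear_outer_measure_empty linear_outer_measure_mono linear_outer_measure_UN)

lemmas linear_outer_measure_Un = outer_measure_space_Un[OF outer_measure_space_linear]

text \<open>A covering set of diameter at most \<open>\<delta> < e\<close> cannot meet both
  \<open>A\<close> and \<open>B\<close>, so every cover of the union splits into a cover of
  \<open>A\<close> and a cover of \<open>B\<close>.\<close>

lemma linear_premeasure_separated:
  assumes "\<delta> < e" and sep: "\<And>x y. x \<in> A \<Longrightarrow> y \<in> B \<Longrightarrow> e \<le> dist x y"
    and "0 < \<delta>"
  shows "linear_premeasure \<delta> A + linear_premeasure \<delta> B \<le> linear_premeasure \<delta> (A \<union> B)"
proof -
  have "linear_premeasure \<delta> A + linear_premeasure \<delta> B \<le> (\<Sum>i. ennreal (diameter (X i)))"
    if X: "A \<union> B \<subseteq> (\<Union>i. X i)" "\<And>i. bounded (X i)" "\<And>i. diameter (X i) \<le> \<delta>"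
    for X :: "nat \<Rightarrow> complex set"
  proof -
    define Y where "Y i = (if X i \<inter> A = {} then {} else X i)" for i
    define Z where "Z i = (if X i \<inter> B = {} then {} else X i)" for i
    have "linear_premeasure \<delta> A + linear_premeasure \<delta> B
        \<le> (\<Sum>i. ennreal (diameter (Y i))) + (\<Sum>i. ennreal (diameter (Z i)))"
    proof (intro add_mono linear_premeasure_le)
      show "A \<subseteq> (\<Union>i. Y i)"
      proof
        fix x assume x: "x \<in> A"
        with X(1) obtain i where "x \<in> X i" by auto
        then have "x \<in> Y i" using x by (auto simp: Y_def)
        then show "x \<in> (\<Union>i. Y i)" by blast
      qed
      show "B \<subseteq> (\<Union>i. Z i)"
      proof
        fix x assume x: "x \<in> B"
        with X(1) obtain i where "x \<in> X i" by auto
        then have "x \<in> Z i" using x by (auto simp: Z_def)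
        then show "x \<in> (\<Union>i. Z i)" by blast
      qed
    qed (use X \<open>0 < \<delta>\<close> in \<open>auto simp: Y_def Z_def\<close>)
    also have "\<dots> = (\<Sum>i. ennreal (diameter (Y i)) + ennreal (diameter (Z i)))"
      by (intro suminf_add summableI)
    also have "\<dots> \<le> (\<Sum>i. ennreal (diameter (X i)))"
    proof (intro suminf_le summableI)
      fix i
      have "Y i = {} \<or> Z i = {}"
      proof (rule ccontr)
        assume "\<not> ?thesis"
        then have "X i \<inter> A \<noteq> {}" "X i \<inter> B \<noteq> {}" by (auto simp: Y_def Z_def)
        then obtain x y where "x \<in> X i" "x \<in> A" "y \<in> X i" "y \<in> B" by auto
        with sep[of x y] diameter_bounded_bound[OF X(2), of x i y] X(3)[of i] \<open>\<delta> < e\<close>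
        show False by auto
      qed
      then show "ennreal (diameter (Y i)) + ennreal (diameter (Z i)) \<le> ennreal (diameter (X i))"
      proof
        assume "Y i = {}"
        then show ?thesis by (simp add: Z_def)
      next
        assume "Z i = {}"
        then show ?thesis by (simp add: Y_def)
      qed
    qed
    finally show ?thesis .
  qed
  then show ?thesis unfolding linear_premeasure_def[of _ "A \<union> B"] by (intro INF_greatest) auto
qed

lemma linear_outer_measure_separated:
  assumes "0 < e" and sep: "\<And>x y. x \<in> A \<Longrightarrow> y \<in> B \<Longrightarrow> e \<le> dist x y"
  shows "linear_outer_measure A + linear_outer_measure B \<le> linear_outer_measure (A \<union> B)"
proof -
  have *: "linear_premeasure \<delta> A + linear_premeasure \<delta>' B \<le> linear_outer_measure (A \<union> B)"
    if "0 < \<delta>" "0 < \<delta>'" for \<delta> \<delta>'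
  proof -
    \<comment> \<open>One scale that is finer than both given scales and smaller than the separation
      \<open>e\<close>.\<close>
    define \<eta> where "\<eta> = min (e / 2) (min \<delta> \<delta>')"
    have "linear_premeasure \<delta> A + linear_premeasure \<delta>' B \<le> linear_premeasure \<eta> A + linear_premeasure \<eta> B"
      by (intro add_mono linear_premeasure_antimono) (auto simp: \<eta>_def)
    also have "\<dots> \<le> linear_premeasure \<eta> (A \<union> B)"
      using that \<open>0 < e\<close> by (intro linear_premeasure_separated[OF _ sep]) (auto simp: \<eta>_def)
    also have "\<dots> \<le> linear_outer_measure (A \<union> B)"
      using that \<open>0 < e\<close> by (intro linear_outer_measure_upper) (auto simp: \<eta>_def)
    finally show ?thesis .
  qed
  have "linear_outer_measure A + linear_premeasure \<delta>' B \<le> linear_outer_measure (A \<union> B)" if "0 < \<delta>'" for \<delta>'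
    unfolding linear_outer_measure_eq[of A] using *[OF _ that]
    by (subst ennreal_SUP_add_left[symmetric]) (auto intro!: SUP_least)
  then show ?thesis
    unfolding linear_outer_measure_eq[of B]
    by (subst ennreal_SUP_add_right[of "{0<..}"]) (auto intro!: SUP_least)
qed

text \<open>The sets measurable in Caratheodory's sense form a sigma-algebra on which the outer
  measure is countably additive; it contains the closed sets, hence all Borel sets.\<close>

lemma measure_space_linear: "measure_space UNIV (sets borel) linear_outer_measure"
proof -
  interpret sigma_algebra UNIV "Pow (UNIV :: complex set)" by (rule sigma_algebra_Pow)
  have ms: "measure_space UNIV (lambda_system UNIV (Pow UNIV) linear_outer_measure) linear_outer_measure"
    by (rule caratheodory_lemma[OF outer_measure_space_linear])
  have "sets borel \<subseteq> lambda_system UNIV (Pow UNIV) linear_outer_measure"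
  proof -
    have "sigma_algebra UNIV (lambda_system UNIV (Pow UNIV) linear_outer_measure)"
      using ms by (simp add: measure_space_def)
    moreover have "Collect closed \<subseteq> lambda_system UNIV (Pow UNIV) linear_outer_measure"
    proof
      fix C :: "complex set" assume "C \<in> Collect closed"
      then have "closed C" by simp
      then show "C \<in> lambda_system UNIV (Pow UNIV) linear_outer_measure"
        by (rule metric_outer_measure_closed[OF outer_measure_space_linear, rotated])
          (rule linear_outer_measure_separated)
    qed
    ultimately have "sigma_sets UNIV (Collect closed) \<subseteq> lambda_system UNIV (Pow UNIV) linear_outer_measure"
      by (rule sigma_algebra.sigma_sets_subset)
    then show ?thesis by (simp add: borel_eq_closed)
  qed
  then show ?thesis
    by (intro measure_down[OF ms]) (metis sets.sigma_algebra_axioms space_borel, auto)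
qed

lemma sets_linear_measure_on [simp, measurable_cong]: "sets (linear_measure_on B) = sets borel"
  using sigma_algebra.sets_measure_of_eq[of UNIV "sets borel"] sets.sigma_algebra_axioms[of borel]
  by (simp add: linear_measure_on_def space_borel)

lemma space_linear_measure_on [simp]: "space (linear_measure_on B) = UNIV"
  by (simp add: linear_measure_on_def space_measure_of_conv)

text \<open>\<open>measure_of\<close> takes the prescribed values once the set function is known to
  be countably additive. Closedness of \<open>B\<close> makes each \<open>A \<inter> B\<close>
  Borel, so additivity of the linear measure applies.\<close>

lemma emeasure_linear_measure_on:
  assumes "closed B" "A \<in> sets borel"
  shows "emeasure (linear_measure_on B) A = linear_outer_measure (A \<inter> B)"
  unfolding linear_measure_on_def
proof (rule emeasure_measure_of_sigma)
  have B: "B \<in> sets borel" using assms by simp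
  have ca: "countably_additive (sets borel) linear_outer_measure"
    using measure_space_linear by (simp add: measure_space_def)
  show "sigma_algebra UNIV (sets (borel :: complex measure))"
    using sets.sigma_algebra_axioms[of "borel :: complex measure"] by simp
  show "positive (sets borel) (\<lambda>A. linear_outer_measure (A \<inter> B))"
    by (simp add: positive_def linear_outer_measure_empty)
  show "countably_additive (sets borel) (\<lambda>A. linear_outer_measure (A \<inter> B))"
  proof (rule countably_additiveI)
    fix A :: "nat \<Rightarrow> complex set"
    assume A: "range A \<subseteq> sets borel" "disjoint_family A"
    have "(\<Sum>i. linear_outer_measure (A i \<inter> B)) = linear_outer_measure (\<Union>i. A i \<inter> B)"
      using A B by (intro ca[unfolded countably_additive_def, rule_format])
        (auto simp: disjoint_family_on_def)
    then show "(\<Sum>i. linear_outer_measure (A i \<inter> B)) = linear_outer_measure (\<Union> (range A) \<inter> B)"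
      by (simp only: Int_commute[of _ B] Int_UN_distrib)
  qed
qed fact

subsection \<open>Length of projections and of convex curves\<close>

text \<open>Cut the parameter interval into \<open>N\<close> equal pieces. Their images have
  diameter at most \<open>L / N\<close>, which is at most \<open>\<delta>\<close> for large
  \<open>N\<close>, and these bounds sum to \<open>L\<close>.\<close>

lemma linear_outer_measure_path_le:
  fixes f :: "real \<Rightarrow> complex"
  assumes lip: "\<And>s t. dist (f s) (f t) \<le> \<bar>s - t\<bar>" and "0 \<le> L"
  shows "linear_outer_measure (f ` {0..L}) \<le> ennreal L"
  unfolding linear_outer_measure_eq
proof (rule SUP_least)
  fix \<delta> :: real assume "\<delta> \<in> {0<..}"
  then have "\<delta> > 0" by simp
  obtain N :: nat where N: "L / \<delta> < real N" using reals_Archimedean2 by blast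
  have "N > 0" using N \<open>\<delta> > 0\<close> \<open>0 \<le> L\<close> by (cases N) (auto simp: divide_less_0_iff)
  have LN: "L / N \<le> \<delta>" using N \<open>\<delta> > 0\<close> \<open>N > 0\<close> by (simp add: field_simps)
  define X where "X i = (if i < N then f ` {real i * (L / N)..real (Suc i) * (L / N)} else {})" for i
  have dX: "dist x y \<le> L / N" if "x \<in> X i" "y \<in> X i" for x y i
  proof -
    from that obtain s t where "s \<in> {real i * (L / N)..real (Suc i) * (L / N)}"
      "t \<in> {real i * (L / N)..real (Suc i) * (L / N)}" "x = f s" "y = f t"
      by (auto simp: X_def split: if_splits)
    with lip[of s t] show ?thesis by (auto simp: algebra_simps add_divide_distrib)
  qed
  have dX': "diameter (X i) \<le> L / N" for i
    by (rule diameter_le) (use dX[of _ i] \<open>0 \<le> L\<close> in \<open>auto simp: dist_norm\<close>)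
  have "linear_premeasure \<delta> (f ` {0..L}) \<le> (\<Sum>i. ennreal (diameter (X i)))"
  proof (rule linear_premeasure_le)
    show "f ` {0..L} \<subseteq> (\<Union>i. X i)"
    proof
      fix z assume "z \<in> f ` {0..L}"
      then obtain t where t: "0 \<le> t" "t \<le> L" "z = f t" by auto
      show "z \<in> (\<Union>i. X i)"
      \<comment> \<open>The right end point goes to the last piece: for \<open>L > 0\<close> the
        floor formula would give it the index \<open>N\<close>. If \<open>L = 0\<close>, only this
        case arises.\<close>
      proof (cases "t = L")
        case True
        have "real (N - 1) * (L / N) \<le> t" "t \<le> real (Suc (N - 1)) * (L / N)"
          using True \<open>N > 0\<close> \<open>0 \<le> L\<close> by (auto simp: field_simps of_nat_diff)
        then have "z \<in> X (N - 1)" using \<open>N > 0\<close> t by (auto simp: X_def)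
        then show ?thesis by blast
      next
        case False
        with t have "L > 0" "t < L" by auto
        define i where "i = nat \<lfloor>t / (L / N)\<rfloor>"
        have "0 \<le> t / (L / N)" using t \<open>L > 0\<close> by simp
        then have i: "real i \<le> t / (L / N)" "t / (L / N) < real (Suc i)"
          unfolding i_def by linarith+
        have "t / (L / N) < N" using \<open>t < L\<close> \<open>L > 0\<close> \<open>N > 0\<close> by (simp add: field_simps)
        with i have "i < N" by linarith
        have "real i * (L / N) \<le> t" "t \<le> real (Suc i) * (L / N)"
          using i \<open>L > 0\<close> \<open>N > 0\<close> by (auto simp: field_simps)
        then have "z \<in> X i" using \<open>i < N\<close> t by (auto simp: X_def)
        then show ?thesis by blast
      qed
    qed
    show "bounded (X i)" for i using dX[of _ i] bounded_two_points by blast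
    show "diameter (X i) \<le> \<delta>" for i using dX'[of i] LN by simp
  qed
  also have "\<dots> = (\<Sum>i<N. ennreal (diameter (X i)))"
    by (rule suminf_finite) (auto simp: X_def)
  also have "\<dots> \<le> (\<Sum>i<N. ennreal (L / N))"
    by (intro sum_mono ennreal_leI dX')
  also have "\<dots> = ennreal L"
    using \<open>N > 0\<close> \<open>0 \<le> L\<close> by (simp add: ennreal_of_nat_eq_real_of_nat flip: ennreal_mult)
  finally show "linear_premeasure \<delta> (f ` {0..L}) \<le> ennreal L" .
qed

text \<open>A map that does not increase distances sends each covering set into an interval no
  longer than its diameter; countable subadditivity of Lebesgue measure on the line then bounds the
  sum of the diameters from below.\<close>

lemma linear_outer_measure_ge_projection:
  fixes \<phi> :: "complex \<Rightarrow> real"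
  assumes lip: "\<And>x y. \<bar>\<phi> x - \<phi> y\<bar> \<le> dist x y" and sub: "{s..t} \<subseteq> \<phi> ` A"
  shows "ennreal (t - s) \<le> linear_outer_measure A"
proof -
  have "ennreal (t - s) \<le> (\<Sum>i. ennreal (diameter (X i)))"
    if X: "A \<subseteq> (\<Union>i. X i)" "\<And>i. bounded (X i)" for X :: "nat \<Rightarrow> complex set"
  proof -
    \<comment> \<open>The smallest closed interval containing the image of
      \<open>X i\<close>.\<close>
    define J where "J i = (if X i = {} then {} else {Inf (\<phi> ` X i)..Sup (\<phi> ` X i)})" for i
    have bd: "\<bar>\<phi> x - \<phi> y\<bar> \<le> diameter (X i)" if "x \<in> X i" "y \<in> X i" for x y i
      using lip[of x y] diameter_bounded_bound[OF X(2) that] by simp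
    have bdd: "bdd_above (\<phi> ` X i)" "bdd_below (\<phi> ` X i)" for i
    proof -
      show "bdd_above (\<phi> ` X i)"
      proof (cases "X i = {}")
        case False
        then obtain y where "y \<in> X i" by auto
        then show ?thesis
          using bd[of _ i y] by (intro bdd_aboveI2[of _ _ "\<phi> y + diameter (X i)"]) fastforce
      qed simp
      show "bdd_below (\<phi> ` X i)"
      proof (cases "X i = {}")
        case False
        then obtain y where "y \<in> X i" by auto
        then show ?thesis
          using bd[of _ i y] by (intro bdd_belowI2[of _ "\<phi> y - diameter (X i)"]) fastforce
      qed simp
    qed
    have J: "emeasure lborel (J i) \<le> ennreal (diameter (X i))" for i
    proof (cases "X i = {}")
      case False
      have "Sup (\<phi> ` X i) \<le> Inf (\<phi> ` X i) + diameter (X i)"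
      proof (rule cSUP_least[OF False])
        fix x assume "x \<in> X i"
        have "\<phi> x - diameter (X i) \<le> Inf (\<phi> ` X i)"
          by (rule cINF_greatest[OF False]) (use bd[OF \<open>x \<in> X i\<close>] in fastforce)
        then show "\<phi> x \<le> Inf (\<phi> ` X i) + diameter (X i)" by simp
      qed
      moreover obtain y where "y \<in> X i" using False by auto
      then have "Inf (\<phi> ` X i) \<le> Sup (\<phi> ` X i)"
        using bdd[of i] by (meson cINF_lower cSUP_upper order.trans)
      ultimately show ?thesis using False by (simp add: J_def ennreal_leI)
    qed (simp add: J_def)
    have "{s..t} \<subseteq> (\<Union>i. J i)"
    proof
      fix r assume "r \<in> {s..t}"
      with sub obtain x where x: "x \<in> A" "r = \<phi> x" by auto
      with X(1) obtain i where i: "x \<in> X i" by auto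
      then have "r \<in> J i"
        using x cINF_lower[OF bdd(2) i] cSUP_upper[OF i bdd(1)] by (auto simp: J_def)
      then show "r \<in> (\<Union>i. J i)" by blast
    qed
    then have "emeasure lborel {s..t} \<le> emeasure lborel (\<Union>i. J i)"
      by (intro emeasure_mono) (auto simp: J_def)
    also have "\<dots> \<le> (\<Sum>i. emeasure lborel (J i))"
      by (intro emeasure_subadditive_countably) (auto simp: J_def)
    also have "\<dots> \<le> (\<Sum>i. ennreal (diameter (X i)))"
      by (intro suminf_le J summableI)
    finally show ?thesis by (cases "s \<le> t") (auto simp: ennreal_neg)
  qed
  then have "ennreal (t - s) \<le> linear_premeasure 1 A"
    unfolding linear_premeasure_def by (intro INF_greatest) auto
  also have "\<dots> \<le> linear_outer_measure A" by (rule linear_outer_measure_upper) simp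
  finally show ?thesis .
qed

section \<open>Upper bounds for the length of the boundary of a convex set\<close>

text \<open>An empty interior puts \<open>K\<close> into a hyperplane, whose normal serves.
  Otherwise interior and relative interior agree, and there is a supporting hyperplane at
  \<open>z\<close>; the sign is chosen so that the vector points away from \<open>K\<close>.\<close>

lemma frontier_supporting_vector:
  fixes K :: "'a::euclidean_space set"
  assumes "convex K" "closed K" "z \<in> frontier K"
  obtains u where "u \<noteq> 0" "\<And>y. y \<in> K \<Longrightarrow> u \<bullet> (y - z) \<le> 0"
proof -
  have z: "z \<in> K" "z \<notin> interior K" using assms by (auto simp: frontier_def)
  have "\<exists>a. a \<noteq> 0 \<and> (\<forall>y\<in>K. a \<bullet> z \<le> a \<bullet> y)"
  proof (cases "interior K = {}")
    case True
    from empty_interior_subset_hyperplane[OF assms(1) this] obtain a b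
      where "a \<noteq> 0" "K \<subseteq> {x. a \<bullet> x = b}" by blast
    then have "a \<bullet> z = b" "\<forall>y\<in>K. a \<bullet> y = b" using z by auto
    then show ?thesis using \<open>a \<noteq> 0\<close> by (intro exI[of _ a]) auto
  next
    case False
    then have "z \<notin> rel_interior K" using z by (simp add: rel_interior_nonempty_interior)
    then show ?thesis
      using supporting_hyperplane_rel_boundary[OF assms(1) z(1)] by metis
  qed
  then obtain a where "a \<noteq> 0" "\<forall>y\<in>K. a \<bullet> z \<le> a \<bullet> y" by blast
  then show ?thesis by (intro that[of "-a"]) (auto simp: inner_diff_right)
qed

text \<open>The nearest point projection onto \<open>K\<close> does not increase lengths and maps the boundary of
  the square onto the frontier of \<open>K\<close>.\<close>
lemma linear_outer_measure_frontier_le: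
  assumes K: "compact K" "convex K" "K \<noteq> {}" and "0 \<le> L"
    and box: "\<And>z. z \<in> K \<Longrightarrow> Re z \<in> {x..x + L} \<and> Im z \<in> {y..y + L}"
  shows "linear_outer_measure (frontier K) \<le> ennreal (4 * L)"
proof -
  have "closed K" using K by (simp add: compact_imp_closed)
  define P where "P = closest_point K"
  define S1 S2 S3 S4 where "S1 = (\<lambda>t. P (Complex (x + t) y)) ` {0..L}"
    and "S2 = (\<lambda>t. P (Complex (x + t) (y + L))) ` {0..L}"
    and "S3 = (\<lambda>t. P (Complex x (y + t))) ` {0..L}"
    and "S4 = (\<lambda>t. P (Complex (x + L) (y + t))) ` {0..L}"
  have P: "dist (P u) (P v) \<le> dist u v" for u v
    unfolding P_def by (rule closest_point_lipschitz[OF K(2) \<open>closed K\<close> K(3)])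
  have S: "linear_outer_measure S1 \<le> ennreal L" "linear_outer_measure S2 \<le> ennreal L"
    "linear_outer_measure S3 \<le> ennreal L" "linear_outer_measure S4 \<le> ennreal L"
    unfolding S1_def S2_def S3_def S4_def
    by (rule linear_outer_measure_path_le[OF order.trans[OF P] \<open>0 \<le> L\<close>],
        simp add: dist_norm cmod_def)+
  have "frontier K \<subseteq> S1 \<union> S2 \<union> (S3 \<union> S4)"
  proof
    fix z assume z: "z \<in> frontier K"
    obtain u where u: "u \<noteq> 0" "\<And>y. y \<in> K \<Longrightarrow> u \<bullet> (y - z) \<le> 0"
      using frontier_supporting_vector[OF K(2) \<open>closed K\<close> z] by blast
    have "z \<in> K" using z \<open>closed K\<close> by (auto simp: frontier_def)
    define Q where "Q = cbox (Complex x y) (Complex (x + L) (y + L))"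
    have "z \<in> Q" using box[OF \<open>z \<in> K\<close>] by (auto simp: Q_def in_cbox_complex_iff)
    \<comment> \<open>The ray along the outward normal leaves the square at a frontier point; if
      \<open>z\<close> is not interior to the square, \<open>t = 0\<close> works.\<close>
    have "\<exists>t\<ge>0. z + t *\<^sub>R u \<in> frontier Q"
    proof (cases "z \<in> interior Q")
      case True
      have "bounded Q" by (simp add: Q_def)
      then show ?thesis using ray_to_frontier[OF _ True u(1)] by (metis less_imp_le)
    next
      case False
      then show ?thesis using \<open>z \<in> Q\<close> closure_subset[of Q] by (auto simp: frontier_def intro!: exI[of _ 0])
    qed
    then obtain t where t: "t \<ge> 0" "z + t *\<^sub>R u \<in> frontier Q" by blast
    define v where "v = z + t *\<^sub>R u"
    \<comment> \<open>Moving from \<open>z\<close> along an outward normal does not change the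
      nearest point of \<open>K\<close>.\<close>
    have "z = P v"
      unfolding P_def
    proof (rule closest_point_unique[OF K(2) \<open>closed K\<close> \<open>z \<in> K\<close>], intro ballI)
      fix p assume "p \<in> K"
      have "(norm (v - z))\<^sup>2 \<le> (norm (v - p))\<^sup>2"
      proof -
        have "(norm (v - p))\<^sup>2 = (norm (v - z))\<^sup>2 + (norm (z - p))\<^sup>2 + 2 * ((v - z) \<bullet> (z - p))"
          using dot_norm[of "v - z" "z - p"] by simp
        moreover have "(v - z) \<bullet> (z - p) = t * - (u \<bullet> (p - z))"
          by (simp add: v_def inner_diff_right algebra_simps)
        moreover have "0 \<le> t * - (u \<bullet> (p - z))" "0 \<le> (norm (z - p))\<^sup>2" using t(1) u(2)[OF \<open>p \<in> K\<close>] by (simp_all add: mult_nonneg_nonpos)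
        ultimately show ?thesis by linarith
      qed
      then show "dist v z \<le> dist v p" by (simp add: dist_norm)
    qed
    have "v \<in> Q" "v \<notin> box (Complex x y) (Complex (x + L) (y + L))"
      using t(2) by (auto simp: v_def[symmetric] Q_def frontier_cbox)
    then have v: "Re v \<in> {x..x+L}" "Im v \<in> {y..y+L}" "Re v = x \<or> Re v = x + L \<or> Im v = y \<or> Im v = y + L"
      by (auto simp: Q_def in_cbox_complex_iff in_box_complex_iff)
    have "P v \<in> S1" if "Im v = y"
      unfolding S1_def using that v by (intro image_eqI[of _ _ "Re v - x"] arg_cong[of _ _ P]) (auto simp: complex_eq_iff)
    moreover have "P v \<in> S2" if "Im v = y + L"
      unfolding S2_def using that v by (intro image_eqI[of _ _ "Re v - x"] arg_cong[of _ _ P]) (auto simp: complex_eq_iff)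
    moreover have "P v \<in> S3" if "Re v = x"
      unfolding S3_def using that v by (intro image_eqI[of _ _ "Im v - y"] arg_cong[of _ _ P]) (auto simp: complex_eq_iff)
    moreover have "P v \<in> S4" if "Re v = x + L"
      unfolding S4_def using that v by (intro image_eqI[of _ _ "Im v - y"] arg_cong[of _ _ P]) (auto simp: complex_eq_iff)
    ultimately show "z \<in> S1 \<union> S2 \<union> (S3 \<union> S4)" using v(3) \<open>z = P v\<close> by auto
  qed
  then have "linear_outer_measure (frontier K) \<le> linear_outer_measure (S1 \<union> S2 \<union> (S3 \<union> S4))"
    by (rule linear_outer_measure_mono)
  also have "\<dots> \<le> (linear_outer_measure S1 + linear_outer_measure S2)
      + (linear_outer_measure S3 + linear_outer_measure S4)"
    by (rule order.trans[OF linear_outer_measure_Un add_mono[OF linear_outer_measure_Un linear_outer_measure_Un]])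
  also have "\<dots> \<le> (ennreal L + ennreal L) + (ennreal L + ennreal L)"
    by (intro add_mono S)
  also have "\<dots> = ennreal (4 * L)"
    using \<open>0 \<le> L\<close> by (simp flip: ennreal_plus)
  finally show ?thesis .
qed

text \<open>The least real part and the least imaginary part on \<open>K\<close> give the corner of
  a square of side \<open>diameter K\<close> that contains \<open>K\<close>.\<close>

lemma linear_outer_measure_frontier_le_diameter:
  assumes K: "compact K" "convex K" "K \<noteq> {}"
  shows "linear_outer_measure (frontier K) \<le> ennreal (4 * diameter K)"
proof -
  have "bounded K" using K by (simp add: compact_imp_bounded)
  obtain u where u: "u \<in> K" "\<And>z. z \<in> K \<Longrightarrow> Re u \<le> Re z"
    using continuous_attains_inf[OF K(1,3) continuous_on_Re[OF continuous_on_id]] by blast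
  obtain v where v: "v \<in> K" "\<And>z. z \<in> K \<Longrightarrow> Im v \<le> Im z"
    using continuous_attains_inf[OF K(1,3) continuous_on_Im[OF continuous_on_id]] by blast
  show ?thesis
  proof (rule linear_outer_measure_frontier_le[OF K, of _ "Re u" "Im v"])
    show "0 \<le> diameter K" using \<open>bounded K\<close> by (rule diameter_ge_0)
    fix z assume z: "z \<in> K"
    have "Re (z - u) \<le> diameter K"
      using complex_Re_le_cmod[of "z - u"] diameter_bounded_bound[OF \<open>bounded K\<close> z u(1)]
      by (simp add: dist_norm)
    moreover have "Im (z - v) \<le> diameter K"
      using abs_Im_le_cmod[of "z - v"] diameter_bounded_bound[OF \<open>bounded K\<close> z v(1)]
      by (simp add: dist_norm)
    ultimately show "Re z \<in> {Re u..Re u + diameter K} \<and> Im z \<in> {Im v..Im v + diameter K}"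
      using u(2)[OF z] v(2)[OF z] by auto
  qed
qed

text \<open>Frontier points of \<open>K\<close> in the disc are frontier points of the convex set
  \<open>K \<inter> cball a r\<close>, which fits into a square of side
  \<open>2 * r\<close>.\<close>

lemma linear_outer_measure_frontier_Int_cball_le:
  assumes K: "compact K" "convex K" and "a \<in> K" and "0 \<le> r"
  shows "linear_outer_measure (frontier K \<inter> cball a r) \<le> ennreal (8 * r)"
proof -
  have "frontier K \<inter> cball a r \<subseteq> frontier (K \<inter> cball a r)"
    using compact_imp_closed[OF K(1)] interior_mono[of "K \<inter> cball a r" K]
    by (auto simp: frontier_def closed_Int closure_closed)
  then have "linear_outer_measure (frontier K \<inter> cball a r) \<le> linear_outer_measure (frontier (K \<inter> cball a r))"
    by (rule linear_outer_measure_mono)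
  also have "\<dots> \<le> ennreal (4 * (2 * r))"
  proof (rule linear_outer_measure_frontier_le[of _ _ "Re a - r" "Im a - r"])
    show "compact (K \<inter> cball a r)" "convex (K \<inter> cball a r)"
      using K by (auto intro: compact_Int_closed convex_Int)
    show "K \<inter> cball a r \<noteq> {}" using \<open>a \<in> K\<close> \<open>0 \<le> r\<close> by (auto intro!: exI[of _ a])
    show "0 \<le> 2 * r" using \<open>0 \<le> r\<close> by simp
    fix z assume "z \<in> K \<inter> cball a r"
    then show "Re z \<in> {Re a - r..Re a - r + 2 * r} \<and> Im z \<in> {Im a - r..Im a - r + 2 * r}"
      using abs_Re_le_cmod[of "a - z"] abs_Im_le_cmod[of "a - z"] by (auto simp: dist_norm)
  qed
  finally show ?thesis by simp
qed

lemma compact_line_meets_frontier: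
  fixes K :: "'a::euclidean_space set"
  assumes "compact K" "z \<in> K" "l \<noteq> 0"
  obtains t where "z + t *\<^sub>R l \<in> frontier K"
proof (cases "z \<in> interior K")
  case True
  then show ?thesis using ray_to_frontier[OF compact_imp_bounded[OF assms(1)] True assms(3)] that by metis
next
  case False
  then have "z + 0 *\<^sub>R l \<in> frontier K"
    using assms by (simp add: frontier_def compact_imp_closed)
  then show ?thesis by (rule that)
qed

subsection \<open>The model polynomial on the chord from -1 to 1\<close>

context
  fixes k l :: nat
begin

definition chord_val :: "complex \<Rightarrow> complex" where
  "chord_val z = (z + 1) ^ k * (z - 1) ^ l"

text \<open>The derivative of \<open>chord_val\<close>, written out. A truncated exponent
  \<open>k - 1\<close> or \<open>l - 1\<close> does no harm, because its term has the factor
  0.\<close>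

definition chord_deriv :: "complex \<Rightarrow> complex" where
  "chord_deriv z = of_nat k * (z + 1) ^ (k - 1) * (z - 1) ^ l + of_nat l * (z + 1) ^ k * (z - 1) ^ (l - 1)"

text \<open>This is the logarithmic derivative \<open>k / (z + 1) + l / (z - 1)\<close> cleared of
  denominators.\<close>

lemma chord_deriv_times: "chord_deriv z * (z\<^sup>2 - 1) = (of_nat (k + l) * z + (of_nat l - of_nat k)) * chord_val z"
proof -
  have k: "of_nat k * (z + 1) ^ (k - 1) * (z + 1) = of_nat k * (z + 1) ^ k"
    by (cases k) auto
  have l: "of_nat l * (z - 1) ^ (l - 1) * (z - 1) = of_nat l * (z - 1) ^ l"
    by (cases l) auto
  have "chord_deriv z * (z\<^sup>2 - 1) = (of_nat k * (z + 1) ^ (k - 1) * (z + 1)) * ((z - 1) ^ l * (z - 1))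
      + (of_nat l * (z - 1) ^ (l - 1) * (z - 1)) * ((z + 1) ^ k * (z + 1))"
    unfolding chord_deriv_def by (simp add: algebra_simps power2_eq_square)
  also have "\<dots> = (of_nat (k + l) * z + (of_nat l - of_nat k)) * chord_val z"
    unfolding k l chord_val_def by (simp add: algebra_simps)
  finally show ?thesis .
qed

lemma cmod_chord_deriv_le:
  "cmod (chord_deriv z) \<le> real k * cmod (z + 1) ^ (k - 1) * cmod (z - 1) ^ l
     + real l * cmod (z + 1) ^ k * cmod (z - 1) ^ (l - 1)"
  unfolding chord_deriv_def by (rule order.trans[OF norm_triangle_ineq]) (simp add: norm_mult norm_power)

lemma cmod_chord_val: "cmod (chord_val z) = cmod (z + 1) ^ k * cmod (z - 1) ^ l"
  by (simp add: chord_val_def norm_mult norm_power)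

lemma cmod_square_minus_1: "cmod (z + 1) * cmod (z - 1) = cmod (z\<^sup>2 - 1)"
  by (simp add: power2_eq_square algebra_simps flip: norm_mult)

lemma cmod_square_minus_1_ge: "1 - (Re z)\<^sup>2 \<le> cmod (z\<^sup>2 - 1)"
proof -
  have "1 - (Re z)\<^sup>2 \<le> \<bar>Re (z\<^sup>2 - 1)\<bar>" by (simp add: Re_power2) (smt (verit) zero_le_power2)
  also have "\<dots> \<le> cmod (z\<^sup>2 - 1)" by (rule abs_Re_le_cmod)
  finally show ?thesis .
qed

lemma cmod_square_minus_1_power2:
  "(cmod (z\<^sup>2 - 1))\<^sup>2 = (1 - (Re z)\<^sup>2)\<^sup>2 + 2 * (Im z)\<^sup>2 * (1 + (Re z)\<^sup>2) + ((Im z)\<^sup>2)\<^sup>2"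
  unfolding cmod_power2 by (simp add: Re_power2 Im_power2) (simp add: power2_eq_square power4_eq_xxxx algebra_simps)

text \<open>In a vertical strip real parts suffice: \<open>chord_val\<close> is
  \<open>(z\<^sup>2 - 1) ^ k\<close> times the leftover \<open>(z - 1) ^ (l - k)\<close>, and both
  bases are bounded below through their real parts.\<close>

lemma cmod_chord_val_ge:
  assumes "k \<le> l" and X: "\<bar>Re z\<bar> \<le> r" and "r \<le> 1"
  shows "(1 - r\<^sup>2) ^ k * (1 - r) ^ (l - k) \<le> cmod (chord_val z)"
proof -
  have r: "(Re z)\<^sup>2 \<le> r\<^sup>2" "r\<^sup>2 \<le> 1"
    using power_mono[OF X abs_ge_zero, of 2] X \<open>r \<le> 1\<close> by (auto simp: power_le_one)
  have "cmod (chord_val z) = cmod (z\<^sup>2 - 1) ^ k * cmod (z - 1) ^ (l - k)"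
    unfolding cmod_chord_val cmod_square_minus_1[symmetric]
    using \<open>k \<le> l\<close> by (simp add: power_mult_distrib flip: power_add)
  also have "(1 - r\<^sup>2) ^ k * (1 - r) ^ (l - k) \<le> \<dots>"
  proof (intro mult_mono power_mono)
    show "1 - r\<^sup>2 \<le> cmod (z\<^sup>2 - 1)" using cmod_square_minus_1_ge[of z] r by simp
    show "1 - r \<le> cmod (z - 1)" using abs_Re_le_cmod[of "z - 1"] X by simp
  qed (use r \<open>r \<le> 1\<close> in auto)
  finally show ?thesis .
qed

section \<open>Derivative bounds for a small width ratio\<close>

text \<open>Write \<open>n = k + l\<close>. In \<open>chord_deriv_times\<close>, \<open>|z|\<close>
  is at most \<open>4 W\<close> since 12 + 3 is below 16, and \<open>|l - k|\<close> is at most 1,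
  hence at most \<open>n W\<close>; so the linear factor is at most \<open>5 n W\<close>. The factor
  \<open>z\<^sup>2 - 1\<close> has modulus at least \<open>1 - 12 / 16\<close>. The unit
  \<open>n W / 4\<close> becomes \<open>n w / d\<^sup>2\<close> when the coordinate is scaled
  back.\<close>

lemma cmod_chord_deriv_flat_near:
  assumes "k \<le> l" "l \<le> k + 1" and "W \<le> 1 / 4" "0 < W" and n: "1 \<le> real (k + l) * W"
    and X: "(Re z)\<^sup>2 \<le> 12 * W\<^sup>2" and Y: "(Im z)\<^sup>2 \<le> 3 * W\<^sup>2"
  shows "cmod (chord_deriv z) \<le> 121 * (real (k + l) * W / 4) * cmod (chord_val z)"
proof -
  have "W\<^sup>2 \<le> (1 / 4)\<^sup>2" using assms by (intro power_mono) auto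
  then have s: "1 / 4 \<le> cmod (z\<^sup>2 - 1)"
    using cmod_square_minus_1_ge[of z] X by (simp add: power2_eq_square)
  have "(cmod z)\<^sup>2 \<le> 16 * W\<^sup>2"
    unfolding cmod_power2 using X Y zero_le_power2[of W] by linarith
  then have "(cmod z)\<^sup>2 \<le> (4 * W)\<^sup>2" by (simp add: power_mult_distrib)
  then have z: "cmod z \<le> 4 * W" by (rule power2_le_imp_le) (use \<open>0 < W\<close> in simp)
  have "cmod (of_nat (k + l) * z + (of_nat l - of_nat k)) \<le> real (k + l) * cmod z + 1"
  proof -
    have "cmod (of_nat l - of_nat k) \<le> 1"
      using assms(1,2) by (simp add: norm_of_nat flip: of_nat_diff)
    then show ?thesis
      by (intro order.trans[OF norm_triangle_ineq]) (simp add: norm_mult flip: of_nat_add)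
  qed
  also have "\<dots> \<le> real (k + l) * (4 * W) + real (k + l) * W"
    using n z by (intro add_mono mult_left_mono) auto
  finally have e: "cmod (of_nat (k + l) * z + (of_nat l - of_nat k)) \<le> 5 * real (k + l) * W"
    by (simp add: algebra_simps)
  have "cmod (chord_deriv z) * (1 / 4) \<le> cmod (chord_deriv z) * cmod (z\<^sup>2 - 1)"
    using s by (intro mult_left_mono) auto
  also have "\<dots> = cmod (of_nat (k + l) * z + (of_nat l - of_nat k)) * cmod (chord_val z)"
    using chord_deriv_times[of z] by (metis norm_mult)
  also have "\<dots> \<le> (5 * real (k + l) * W) * cmod (chord_val z)" using e by (intro mult_right_mono) auto
  finally have "cmod (chord_deriv z) \<le> 80 * (real (k + l) * W / 4) * cmod (chord_val z)"
    by (simp add: algebra_simps)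
  also have "\<dots> \<le> 121 * (real (k + l) * W / 4) * cmod (chord_val z)"
    using \<open>0 < W\<close> by (intro mult_right_mono) auto
  finally show ?thesis .
qed

text \<open>Away from the centre \<open>|z\<^sup>2 - 1|\<close> falls below 1 by a multiple of
  \<open>W\<^sup>2\<close>. Taking out \<open>k - 1\<close> such factors leaves at most two linear
  factors in each term, each at most 2.\<close>

lemma cmod_chord_deriv_flat_far:
  assumes "1 \<le> k" "k \<le> l" "l \<le> k + 1" and "W \<le> 1 / 4" "0 < W"
    and X: "12 * W\<^sup>2 \<le> (Re z)\<^sup>2" "\<bar>Re z\<bar> \<le> 1" and Y: "(Im z)\<^sup>2 \<le> 3 * W\<^sup>2"
    and le: "cmod (z + 1) \<le> 2" "cmod (z - 1) \<le> 2"
  shows "cmod (chord_deriv z) \<le> 4 * real (k + l) * (1 - 6/5 * W\<^sup>2) ^ (k - 1)"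
proof -
  have W: "W\<^sup>2 \<le> 1 / 16" using power_mono[of W "1/4" 2] assms by (simp add: power2_eq_square)
  have X1: "(Re z)\<^sup>2 \<le> 1" using X(2) by (simp add: abs_square_le_1)
  have s: "cmod (z\<^sup>2 - 1) \<le> 1 - 6/5 * W\<^sup>2"
  proof (rule power2_le_imp_le)
    have "(cmod (z\<^sup>2 - 1))\<^sup>2 \<le> (1 - 12 * W\<^sup>2)\<^sup>2 + 2 * (3 * W\<^sup>2) * (1 + 1) + (3 * W\<^sup>2)\<^sup>2"
      unfolding cmod_square_minus_1_power2 using X X1 Y by (intro add_mono mult_mono power_mono) auto
    also have "\<dots> = 1 - 12 * W\<^sup>2 + 153 * (W\<^sup>2 * W\<^sup>2)" by (simp add: power2_eq_square algebra_simps)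
    also have "\<dots> \<le> 1 - 12 * W\<^sup>2 + 153 * (W\<^sup>2 * (1 / 16))"
      using W by (intro add_left_mono mult_left_mono) auto
    \<comment> \<open>153 / 16 is less than 12 - 12 / 5.\<close>
    also have "\<dots> \<le> 1 - 12/5 * W\<^sup>2" by simp
    also have "\<dots> \<le> (1 - 6/5 * W\<^sup>2)\<^sup>2" by (simp add: power2_diff)
    finally show "(cmod (z\<^sup>2 - 1))\<^sup>2 \<le> (1 - 6/5 * W\<^sup>2)\<^sup>2" .
    show "0 \<le> 1 - 6/5 * W\<^sup>2" using W by simp
  qed
  have m: "cmod (z - 1) ^ (l - k) \<le> 2"
  proof -
    have "l - k = 0 \<or> l - k = 1" using assms by auto
    then show ?thesis using le by auto
  qed
  have ke: "cmod (z - 1) ^ l = cmod (z - 1) ^ (k - 1) * cmod (z - 1) ^ (l - k) * cmod (z - 1)"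
    "cmod (z - 1) ^ (l - 1) = cmod (z - 1) ^ (k - 1) * cmod (z - 1) ^ (l - k)"
    "cmod (z + 1) ^ k = cmod (z + 1) ^ (k - 1) * cmod (z + 1)"
    using assms(1,2) by (simp_all flip: power_add power_Suc2)
  have "cmod (chord_deriv z) \<le> (cmod (z + 1) * cmod (z - 1)) ^ (k - 1) *
      (real k * (cmod (z - 1) ^ (l - k) * cmod (z - 1)) + real l * (cmod (z - 1) ^ (l - k) * cmod (z + 1)))"
    using cmod_chord_deriv_le[of z] unfolding ke by (simp add: power_mult_distrib algebra_simps)
  also have "\<dots> \<le> (1 - 6/5 * W\<^sup>2) ^ (k - 1) * (real k * (2 * 2) + real l * (2 * 2))"
    unfolding cmod_square_minus_1 using W
    by (intro mult_mono add_mono power_mono s order.refl m le) auto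
  finally show ?thesis by (simp add: algebra_simps)
qed

text \<open>Each factor \<open>1 - 6/5 * W\<^sup>2\<close> is smaller than the central value
  \<open>1 - (W / 2)\<^sup>2\<close> by at least \<open>exp (- (9/10 * W\<^sup>2))\<close>, and the
  lower bound on the degree turns the accumulated gain into
  \<open>(W / 2) powr (1 + \<alpha>)\<close> up to a constant. One power of \<open>W / 2\<close>
  pays for the \<open>W\<close> on the right-hand side; the power \<open>\<alpha>\<close> remains to
  offset the length of the exceptional set.\<close>

lemma flat_far_decay:
  assumes "1 \<le> k" "k \<le> l" "l \<le> k + 1" and W: "W \<le> 1 / 4" "0 < W" and "0 \<le> \<alpha>"
    and n: "8 * (1 + \<alpha>) * ln (2 / W) \<le> real (k + l) * W\<^sup>2"
  shows "4 * real (k + l) * (1 - 6/5 * W\<^sup>2) ^ (k - 1)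
    \<le> 121 * (real (k + l) * W / 4) * ((W / 2) powr \<alpha> * ((1 - (W / 2)\<^sup>2) ^ k * (7 / 8)))"
proof -
  have W2: "W\<^sup>2 \<le> 1 / 16" using power_mono[of W "1/4" 2] W by (simp add: power2_eq_square)
  define L where "L = ln (2 / W)"
  have "L \<ge> 0" using W by (simp add: L_def)
  define j where "j = k - 1"
  have k: "k = Suc j" using \<open>1 \<le> k\<close> by (simp add: j_def)
  have "(1 - 6/5 * W\<^sup>2) ^ j \<le> ((1 - (W / 2)\<^sup>2) * exp (- (9/10 * W\<^sup>2))) ^ j"
  proof (rule power_mono)
    have "1 - 6/5 * W\<^sup>2 \<le> (1 - (W / 2)\<^sup>2) * (1 - 9/10 * W\<^sup>2)"
      using W by (simp add: algebra_simps power2_eq_square)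
    also have "\<dots> \<le> (1 - (W / 2)\<^sup>2) * exp (- (9/10 * W\<^sup>2))"
      using exp_ge_add_one_self[of "- (9/10 * W\<^sup>2)"] W2
      by (intro mult_left_mono) (auto simp: power_divide)
    finally show "1 - 6/5 * W\<^sup>2 \<le> (1 - (W / 2)\<^sup>2) * exp (- (9/10 * W\<^sup>2))" .
  qed (use W2 in auto)
  also have "\<dots> = (1 - (W / 2)\<^sup>2) ^ j * exp (- (9/10 * (real j * W\<^sup>2)))"
    by (simp add: power_mult_distrib exp_of_nat_mult[symmetric] mult_ac)
  \<comment> \<open>Since \<open>k + l \<le> 2 * j + 3\<close>, the degree hypothesis makes
    \<open>j W\<^sup>2\<close> at least \<open>4 (1 + \<alpha>) L - 3 W\<^sup>2 / 2\<close>; the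
    summand 1 absorbs the last term.\<close>
  also have "exp (- (9/10 * (real j * W\<^sup>2))) \<le> exp (1 + - ((1 + \<alpha>) * L))"
  proof -
    have "real (k + l) \<le> 2 * real j + 3" using assms(3) k by simp
    then have "real (k + l) * W\<^sup>2 \<le> (2 * real j + 3) * W\<^sup>2" by (intro mult_right_mono) auto
    then have "8 * ((1 + \<alpha>) * L) \<le> 2 * (real j * W\<^sup>2) + 3 * W\<^sup>2"
      using n by (simp add: L_def algebra_simps)
    moreover have "(1 + \<alpha>) * L \<ge> 0" using \<open>0 \<le> \<alpha>\<close> \<open>L \<ge> 0\<close> by simp
    ultimately show ?thesis using W2 by simp
  qed
  also have "exp (1 + - ((1 + \<alpha>) * L)) = exp 1 * ((W / 2) powr \<alpha> * (W / 2))"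
  proof -
    have "L = - ln (W / 2)" using W by (simp add: L_def ln_div)
    then have "exp (- ((1 + \<alpha>) * L)) = (W / 2) powr (1 + \<alpha>)" using W by (simp add: powr_def)
    then show ?thesis unfolding exp_add using W by (simp add: powr_add mult_ac)
  qed
  also have "exp (1::real) \<le> 3" by (rule exp_le)
  finally have "(1 - 6/5 * W\<^sup>2) ^ j \<le> (1 - (W / 2)\<^sup>2) ^ j * (3 * ((W / 2) powr \<alpha> * (W / 2)))"
    using W W2 by (simp add: mult_left_mono mult_right_mono power_divide)
  \<comment> \<open>The new factor is at least 1 and raises the exponent from \<open>j\<close> to
    \<open>k\<close>.\<close>
  also have "\<dots> \<le> (1 - (W / 2)\<^sup>2) ^ j * (3 * ((W / 2) powr \<alpha> * (W / 2))) * (2 * (1 - (W / 2)\<^sup>2))"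
    using W W2 mult_left_mono[of 1 "2 * (1 - (W / 2)\<^sup>2)" "(1 - (W / 2)\<^sup>2) ^ j * (3 * ((W / 2) powr \<alpha> * (W / 2)))"]
    by (simp add: power_divide)
  also have "\<dots> = 3 * W * ((W / 2) powr \<alpha> * (1 - (W / 2)\<^sup>2) ^ k)"
    by (simp add: k mult_ac)
  finally have *: "(1 - 6/5 * W\<^sup>2) ^ j \<le> 3 * W * ((W / 2) powr \<alpha> * (1 - (W / 2)\<^sup>2) ^ k)" .
  have "4 * real (k + l) * (1 - 6/5 * W\<^sup>2) ^ (k - 1)
     \<le> 4 * real (k + l) * (3 * W * ((W / 2) powr \<alpha> * (1 - (W / 2)\<^sup>2) ^ k))"
    unfolding j_def[symmetric] by (intro mult_left_mono *) auto
  also have "\<dots> = 12 * (real (k + l) * W * ((W / 2) powr \<alpha> * (1 - (W / 2)\<^sup>2) ^ k))" by simp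
  also have "\<dots> \<le> 121 / 4 * 7 / 8 * (real (k + l) * W * ((W / 2) powr \<alpha> * (1 - (W / 2)\<^sup>2) ^ k))"
    using W W2 by (intro mult_right_mono) (auto simp: power_divide)
  finally show ?thesis by (simp add: algebra_simps)
qed

section \<open>Derivative bounds away from and near the two zeros\<close>

lemma cmod_chord_deriv_round_near:
  assumes "1 / 7 \<le> cmod (z + 1)" "1 / 7 \<le> cmod (z - 1)"
  shows "cmod (chord_deriv z) \<le> 7 * real (k + l) * cmod (chord_val z)"
proof -
  have k: "real k * cmod (z + 1) ^ (k - 1) \<le> 7 * (real k * cmod (z + 1) ^ k)"
  proof (cases k)
    case (Suc j)
    show ?thesis using assms(1) mult_left_mono[of 1 "7 * cmod (z + 1)" "real k * cmod (z + 1) ^ j"]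
      by (simp add: Suc mult_ac)
  qed simp
  have l: "real l * cmod (z - 1) ^ (l - 1) \<le> 7 * (real l * cmod (z - 1) ^ l)"
  proof (cases l)
    case (Suc j)
    show ?thesis using assms(2) mult_left_mono[of 1 "7 * cmod (z - 1)" "real l * cmod (z - 1) ^ j"]
      by (simp add: Suc mult_ac)
  qed simp
  have "cmod (chord_deriv z) \<le> 7 * (real k * cmod (z + 1) ^ k) * cmod (z - 1) ^ l
     + 7 * (real l * cmod (z - 1) ^ l) * cmod (z + 1) ^ k"
    using cmod_chord_deriv_le[of z] mult_right_mono[OF k, of "cmod (z - 1) ^ l"]
      mult_right_mono[OF l, of "cmod (z + 1) ^ k"] by (simp add: mult_ac)
  then show ?thesis unfolding cmod_chord_val by (simp add: algebra_simps)
qed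

text \<open>Near a zero one linear factor is at most 1 / 7 and occurs with exponent at least
  \<open>k - 1\<close>; the other is at most 2 and occurs with exponent at most
  \<open>l\<close>.\<close>

lemma cmod_chord_deriv_round_far:
  assumes "k \<le> l" "l \<le> k + 1" "1 \<le> l" and le: "cmod (z + 1) \<le> 2" "cmod (z - 1) \<le> 2"
    and far: "cmod (z + 1) \<le> 1 / 7 \<or> cmod (z - 1) \<le> 1 / 7"
  shows "cmod (chord_deriv z) \<le> real (k + l) * (2 ^ l * (1 / 7) ^ (k - 1))"
proof -
  have "cmod (z + 1) ^ (k - 1) * cmod (z - 1) ^ l \<le> 2 ^ l * (1 / 7) ^ (k - 1)
    \<and> cmod (z + 1) ^ k * cmod (z - 1) ^ (l - 1) \<le> 2 ^ l * (1 / 7) ^ (k - 1)"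
    using far
  proof
    assume a: "cmod (z + 1) \<le> 1 / 7"
    have "cmod (z + 1) ^ (k - 1) * cmod (z - 1) ^ l \<le> (1 / 7) ^ (k - 1) * 2 ^ l"
      using a le by (intro mult_mono power_mono) auto
    moreover have "cmod (z + 1) ^ k * cmod (z - 1) ^ (l - 1) \<le> (1 / 7) ^ k * 2 ^ (l - 1)"
      using a le by (intro mult_mono power_mono) auto
    moreover have "(1 / 7) ^ k * 2 ^ (l - 1) \<le> (1 / 7 :: real) ^ (k - 1) * 2 ^ l"
      by (intro mult_mono power_decreasing power_increasing) auto
    ultimately show ?thesis by (simp add: mult_ac)
  next
    assume a: "cmod (z - 1) \<le> 1 / 7"
    have "cmod (z + 1) ^ (k - 1) * cmod (z - 1) ^ l \<le> 2 ^ (k - 1) * (1 / 7) ^ l"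
      using a le by (intro mult_mono power_mono) auto
    moreover have "2 ^ (k - 1) * (1 / 7 :: real) ^ l \<le> 2 ^ l * (1 / 7) ^ (k - 1)"
      using \<open>k \<le> l\<close> by (intro mult_mono power_decreasing power_increasing) auto
    moreover have "cmod (z + 1) ^ k * cmod (z - 1) ^ (l - 1) \<le> 2 ^ k * (1 / 7) ^ (l - 1)"
      using a le by (intro mult_mono power_mono) auto
    moreover have "2 ^ k * (1 / 7 :: real) ^ (l - 1) \<le> 2 ^ l * (1 / 7) ^ (k - 1)"
      using \<open>k \<le> l\<close> by (intro mult_mono power_decreasing power_increasing) auto
    ultimately show ?thesis by linarith
  qed
  then have "real k * (cmod (z + 1) ^ (k - 1) * cmod (z - 1) ^ l)
      + real l * (cmod (z + 1) ^ k * cmod (z - 1) ^ (l - 1))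
    \<le> real k * (2 ^ l * (1 / 7) ^ (k - 1)) + real l * (2 ^ l * (1 / 7) ^ (k - 1))"
    by (intro add_mono mult_left_mono) auto
  then show ?thesis using cmod_chord_deriv_le[of z] by (simp add: algebra_simps)
qed

text \<open>The decay rate 2 / 7 near the zeros beats the central rate 8 / 9, so only the first
  factors matter; 15 / 2 is large enough for them in all three cases and still below 121 /
  16.\<close>

lemma round_far_decay:
  assumes "k \<le> l" "l \<le> k + 1" "1 \<le> l"
  shows "2 ^ l * (1 / 7) ^ (k - 1) \<le> 15 / 2 * ((1 - (1 / 3)\<^sup>2) ^ k * (1 - 1 / 3 :: real) ^ (l - k))"
proof -
  have j: "(2 / 7) ^ j \<le> (8 / 9 :: real) ^ j" for j :: nat by (rule power_mono) auto
  have p: "2 ^ j * (1 / 7) ^ j = (2 / 7 :: real) ^ j" for j :: nat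
    by (simp flip: power_mult_distrib)
  have "0 \<le> (8 / 9 :: real) ^ j" for j :: nat by simp
  consider "k = 0" "l = 1" | j where "k = Suc j" "l = Suc j" | j where "k = Suc j" "l = Suc (Suc j)"
  proof -
    have "l = k \<or> l = Suc k" using assms by linarith
    then show thesis using that \<open>1 \<le> l\<close> by (cases k) auto
  qed
  then show ?thesis
  proof cases
    case 1
    then show ?thesis by simp
  next
    case 2
    have "2 * (2 ^ j * (1 / 7) ^ j) \<le> 15 / 2 * (8 / 9 * (8 / 9 :: real) ^ j)"
      unfolding p using j[of j] \<open>\<And>j. 0 \<le> (8 / 9 :: real) ^ j\<close>[of j] by linarith
    then show ?thesis using 2 by (simp add: power2_eq_square)
  next
    case 3
    have "4 * (2 ^ j * (1 / 7) ^ j) \<le> 15 / 2 * (8 / 9 * (8 / 9 :: real) ^ j * (2 / 3))"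
      unfolding p using j[of j] \<open>\<And>j. 0 \<le> (8 / 9 :: real) ^ j\<close>[of j] by linarith
    then show ?thesis using 3 by (simp add: power2_eq_square)
  qed
qed

end

subsection \<open>The diametral chord\<close>

definition directional_width :: "complex set \<Rightarrow> real \<Rightarrow> real" where
  "directional_width K \<gamma> =
     (SUP (z, z')\<in>K \<times> K. Re (z * exp (\<i> * of_real \<gamma>)) - Re (z' * exp (\<i> * of_real \<gamma>)))"

lemma width_eq: "width K = (INF \<gamma>\<in>{-pi..pi}. directional_width K \<gamma>)"
  by (simp add: width_def directional_width_def)

lemma
  assumes "compact K" "z \<in> K" "z' \<in> K"
  shows directional_width_ge: "\<bar>Re ((z - z') * exp (\<i> * of_real \<gamma>))\<bar> \<le> directional_width K \<gamma>"
    and directional_width_le: "directional_width K \<gamma> \<le> diameter K"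
proof -
  have b: "Re (u * exp (\<i> * of_real \<gamma>)) - Re (v * exp (\<i> * of_real \<gamma>)) \<le> diameter K"
    if "u \<in> K" "v \<in> K" for u v
  proof -
    have "Re ((u - v) * exp (\<i> * of_real \<gamma>)) \<le> cmod ((u - v) * exp (\<i> * of_real \<gamma>))"
      by (rule complex_Re_le_cmod)
    also have "\<dots> \<le> diameter K"
      using diameter_bounded_bound[OF compact_imp_bounded[OF assms(1)] that]
      by (simp add: norm_mult dist_norm)
    finally show ?thesis by (simp add: left_diff_distrib)
  qed
  then have bdd: "bdd_above ((\<lambda>(z, z'). Re (z * exp (\<i> * of_real \<gamma>)) - Re (z' * exp (\<i> * of_real \<gamma>))) ` (K \<times> K))"
    by (intro bdd_aboveI2[of _ _ "diameter K"]) auto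
  have le: "Re ((u - v) * exp (\<i> * of_real \<gamma>)) \<le> directional_width K \<gamma>" if "u \<in> K" "v \<in> K" for u v
    using cSUP_upper[OF _ bdd, of "(u, v)"] that
    by (simp add: left_diff_distrib directional_width_def)
  show "\<bar>Re ((z - z') * exp (\<i> * of_real \<gamma>))\<bar> \<le> directional_width K \<gamma>"
    using le[OF assms(2,3)] le[OF assms(3,2)] by (simp add: abs_le_iff left_diff_distrib)
  show "directional_width K \<gamma> \<le> diameter K"
    unfolding directional_width_def using assms b by (intro cSUP_least) auto
qed

lemma width_le_diameter:
  assumes "compact K" "K \<noteq> {}"
  shows "width K \<le> diameter K"
proof -
  obtain z where z: "z \<in> K" using assms by auto
  have "width K \<le> directional_width K 0"
    unfolding width_eq using order.trans[OF abs_ge_zero directional_width_ge[OF assms(1) z z]]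
    by (intro cINF_lower bdd_belowI2[of _ 0]) auto
  also have "\<dots> \<le> diameter K" by (rule directional_width_le[OF assms(1) z z])
  finally show ?thesis .
qed

locale diametral_chord =
  fixes K :: "complex set" and a b :: complex and d w :: real
  assumes compact: "compact K" and convex: "convex K" and a: "a \<in> K" and b: "b \<in> K"
    and d: "d = diameter K" and ab: "dist a b = d" and w: "w = width K" and w_pos: "0 < w"
begin

text \<open>The affine coordinate with \<open>a\<close> at -1 and \<open>b\<close> at 1; it
  multiplies distances by \<open>2 / d\<close>.\<close>

definition \<zeta> :: "complex \<Rightarrow> complex" where
  "\<zeta> z = (2 * z - a - b) / (b - a)"

lemma K_nonempty: "K \<noteq> {}" using a by auto

lemma w_le_d: "w \<le> d"
  using width_le_diameter[OF compact K_nonempty] by (simp add: d w)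

lemma d_pos: "0 < d" using w_le_d w_pos by simp

lemma b_neq_a: "b \<noteq> a" using ab d_pos by auto

lemma cmod_ba: "cmod (b - a) = d" using ab by (simp add: dist_norm norm_minus_commute)

lemma minus_a: "z - a = (b - a) / 2 * (\<zeta> z + 1)"
  using b_neq_a by (simp add: \<zeta>_def field_simps)

lemma minus_b: "z - b = (b - a) / 2 * (\<zeta> z - 1)"
  using b_neq_a by (simp add: \<zeta>_def field_simps)

lemma dist_\<zeta>: "dist (\<zeta> x) (\<zeta> y) = 2 / d * dist x y"
proof -
  have "\<zeta> x - \<zeta> y = 2 / (b - a) * (x - y)"
    by (simp add: \<zeta>_def algebra_simps flip: diff_divide_distrib)
  then have "cmod (\<zeta> x - \<zeta> y) = cmod (2 / (b - a)) * cmod (x - y)" by (simp only: norm_mult)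
  then show ?thesis by (simp add: dist_norm norm_divide cmod_ba)
qed

lemma cmod_\<zeta>_plus: "cmod (\<zeta> z + 1) = 2 / d * dist z a"
  using d_pos by (simp add: dist_norm minus_a[of z] norm_mult norm_divide cmod_ba)

lemma cmod_\<zeta>_minus: "cmod (\<zeta> z - 1) = 2 / d * dist z b"
  using d_pos by (simp add: dist_norm minus_b[of z] norm_mult norm_divide cmod_ba)

lemma continuous_on_\<zeta> [continuous_intros]: "continuous_on A \<zeta>"
  unfolding \<zeta>_def by (intro continuous_intros) (use b_neq_a in auto)

lemma cmod_\<zeta>_le:
  assumes "z \<in> K"
  shows "cmod (\<zeta> z + 1) \<le> 2" "cmod (\<zeta> z - 1) \<le> 2"
proof -
  have "dist z a \<le> d" "dist z b \<le> d"
    using diameter_bounded_bound[OF compact_imp_bounded[OF compact] assms] a b by (auto simp: d)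
  then show "cmod (\<zeta> z + 1) \<le> 2" "cmod (\<zeta> z - 1) \<le> 2"
    unfolding cmod_\<zeta>_plus cmod_\<zeta>_minus using d_pos by (auto simp: field_simps)
qed

text \<open>The image of \<open>K\<close> lies in the lens formed by the discs of radius 2 about -1
  and 1. Adding the two disc inequalities bounds the imaginary part.\<close>

lemma \<zeta>_lens:
  assumes "z \<in> K"
  shows "\<bar>Re (\<zeta> z)\<bar> \<le> 1" "(Im (\<zeta> z))\<^sup>2 \<le> 3"
proof -
  have "(Re (\<zeta> z) + 1)\<^sup>2 + (Im (\<zeta> z))\<^sup>2 \<le> 2\<^sup>2" "(Re (\<zeta> z) - 1)\<^sup>2 + (Im (\<zeta> z))\<^sup>2 \<le> 2\<^sup>2"
    using power_mono[OF cmod_\<zeta>_le(1)[OF assms], of 2] power_mono[OF cmod_\<zeta>_le(2)[OF assms], of 2]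
    by (simp_all add: cmod_power2)
  then show "(Im (\<zeta> z))\<^sup>2 \<le> 3"
    by (simp add: power2_sum power2_diff) (smt (verit) zero_le_power2)
  have "Re (\<zeta> z + 1) \<le> 2" "Re (1 - \<zeta> z) \<le> 2"
    using complex_Re_le_cmod order.trans cmod_\<zeta>_le[OF assms] norm_minus_commute by metis+
  then show "\<bar>Re (\<zeta> z)\<bar> \<le> 1" by simp
qed

text \<open>For a direction \<open>\<gamma>\<close> let \<open>g = c + i s\<close> be the rotated unit vector along the chord. The
  width in that direction bounds \<open>c\<close>, through the chord itself, and \<open>s Im \<zeta>\<close>, through the chord
  from \<open>z\<close> to the end point on its side.\<close>
lemma Im_\<zeta>_le:
  assumes "z \<in> K"
  shows "(Im (\<zeta> z))\<^sup>2 \<le> 3 * (2 * w / d)\<^sup>2"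
proof -
  define X Y where "X = Re (\<zeta> z)" and "Y = Im (\<zeta> z)"
  have X: "\<bar>X\<bar> \<le> 1" and Y: "Y\<^sup>2 \<le> 3" using \<zeta>_lens[OF assms] by (auto simp: X_def Y_def)
  have "d / 2 * (\<bar>Y\<bar> / sqrt 3) \<le> width K"
    unfolding width_eq
  proof (rule cINF_greatest)
    fix \<gamma> :: real
    define W where "W = directional_width K \<gamma>"
    define W' where "W' = 2 * W / d"
    define g where "g = (b - a) * exp (\<i> * of_real \<gamma>) / of_real d"
    define c s where "c = Re g" and "s = Im g"
    have "cmod g = 1" using d_pos by (simp add: g_def norm_mult norm_divide cmod_ba)
    then have cs: "c\<^sup>2 + s\<^sup>2 = 1" by (simp add: c_def s_def cmod_power2[symmetric])
    have g: "(b - a) * exp (\<i> * of_real \<gamma>) = of_real d * g" using d_pos by (simp add: g_def)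
    have "\<bar>Re ((b - a) * exp (\<i> * of_real \<gamma>))\<bar> \<le> W"
      unfolding W_def by (rule directional_width_ge[OF compact b a])
    then have c: "2 * \<bar>c\<bar> \<le> W'"
      unfolding g using d_pos by (simp add: W'_def c_def abs_mult pos_le_divide_eq mult_ac)
    have "\<bar>Re ((z - a) * exp (\<i> * of_real \<gamma>))\<bar> \<le> W"
      unfolding W_def by (rule directional_width_ge[OF compact assms a])
    moreover have "(z - a) * exp (\<i> * of_real \<gamma>) = of_real (d / 2) * (g * (\<zeta> z + 1))"
      unfolding minus_a[of z] using g by (simp add: mult_ac)
    ultimately have "\<bar>Re (of_real (d / 2) * (g * (\<zeta> z + 1)))\<bar> \<le> W" by simp
    also have "Re (of_real (d / 2) * (g * (\<zeta> z + 1))) = d / 2 * (c * (X + 1) - s * Y)"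
      by (simp add: c_def s_def X_def Y_def)
    finally have A: "\<bar>c * (X + 1) - s * Y\<bar> \<le> W'"
      using d_pos by (simp add: W'_def abs_mult pos_le_divide_eq mult_ac)
    have "\<bar>Re ((z - b) * exp (\<i> * of_real \<gamma>))\<bar> \<le> W"
      unfolding W_def by (rule directional_width_ge[OF compact assms b])
    moreover have "(z - b) * exp (\<i> * of_real \<gamma>) = of_real (d / 2) * (g * (\<zeta> z - 1))"
      unfolding minus_b[of z] using g by (simp add: mult_ac)
    ultimately have "\<bar>Re (of_real (d / 2) * (g * (\<zeta> z - 1)))\<bar> \<le> W" by simp
    also have "Re (of_real (d / 2) * (g * (\<zeta> z - 1))) = d / 2 * (c * (X - 1) - s * Y)"
      by (simp add: c_def s_def X_def Y_def)
    finally have B: "\<bar>c * (X - 1) - s * Y\<bar> \<le> W'"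
      using d_pos by (simp add: W'_def abs_mult pos_le_divide_eq mult_ac)
    \<comment> \<open>With the end point on the side of \<open>z\<close>, the coefficient of
      \<open>c\<close> has modulus at most 1, so \<open>|s Y|\<close> is at most
      \<open>W' + |c|\<close>.\<close>
    have "\<bar>s * Y\<bar> \<le> 3 / 2 * W'"
    proof (cases "X \<ge> 0")
      case True
      have "\<bar>c * (X - 1)\<bar> \<le> \<bar>c\<bar> * 1" unfolding abs_mult using X True by (intro mult_left_mono) auto
      then show ?thesis using B c by linarith
    next
      case False
      have "\<bar>c * (X + 1)\<bar> \<le> \<bar>c\<bar> * 1" unfolding abs_mult using X False by (intro mult_left_mono) auto
      then show ?thesis using A c by linarith
    qed
    then have sY: "(s * Y)\<^sup>2 \<le> (3 / 2 * W')\<^sup>2" using power_mono[of "\<bar>s * Y\<bar>" _ 2] by simp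
    have "(2 * \<bar>c\<bar>)\<^sup>2 \<le> W'\<^sup>2" using c by (intro power_mono) auto
    then have "4 * c\<^sup>2 \<le> W'\<^sup>2" by (simp add: power_mult_distrib)
    moreover have "c\<^sup>2 * Y\<^sup>2 \<le> c\<^sup>2 * 3" using Y by (intro mult_left_mono) auto
    ultimately have cY: "c\<^sup>2 * Y\<^sup>2 \<le> 3 / 4 * W'\<^sup>2" by simp
    \<comment> \<open>The shares 3 / 4, which uses \<open>Y\<^sup>2 \<le> 3\<close> from the lens,
      and 9 / 4 add up to 3.\<close>
    have "Y\<^sup>2 = c\<^sup>2 * Y\<^sup>2 + (s * Y)\<^sup>2"
    proof -
      have "Y\<^sup>2 = (c\<^sup>2 + s\<^sup>2) * Y\<^sup>2" using cs by simp
      then show ?thesis by (simp only: distrib_right power_mult_distrib)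
    qed
    also have "\<dots> \<le> 3 * W'\<^sup>2" using cY sY by (simp add: power_mult_distrib power_divide)
    finally have "\<bar>Y\<bar> \<le> sqrt (3 * W'\<^sup>2)" by (intro real_le_rsqrt) simp
    moreover have "0 \<le> W'" using c by linarith
    ultimately have "\<bar>Y\<bar> \<le> sqrt 3 * W'" by (simp add: real_sqrt_mult)
    then show "d / 2 * (\<bar>Y\<bar> / sqrt 3) \<le> W"
      using d_pos by (simp add: W'_def W_def pos_divide_le_eq pos_le_divide_eq mult_ac)
  qed auto
  then have "\<bar>Y\<bar> \<le> sqrt 3 * (2 * w / d)" using d_pos by (simp add: w field_simps)
  then have "\<bar>Y\<bar>\<^sup>2 \<le> (sqrt 3 * (2 * w / d))\<^sup>2" by (intro power_mono) auto
  then show ?thesis by (simp add: Y_def power_mult_distrib power_divide)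
qed

text \<open>Project orthogonally onto the line of the chord. Through every point of the central part
  of the chord, of length \<open>d * r\<close>, the perpendicular meets the frontier inside the
  strip.\<close>

lemma linear_outer_measure_strip_ge:
  assumes "0 \<le> r" "r \<le> 1"
  shows "ennreal (d * r) \<le> linear_outer_measure {z \<in> frontier K. \<bar>Re (\<zeta> z)\<bar> \<le> r}"
proof -
  have "ennreal (d / 2 * r - - (d / 2 * r)) \<le> linear_outer_measure {z \<in> frontier K. \<bar>Re (\<zeta> z)\<bar> \<le> r}"
  proof (rule linear_outer_measure_ge_projection[of "\<lambda>z. d / 2 * Re (\<zeta> z)"])
    fix x y
    have "\<bar>Re (\<zeta> x) - Re (\<zeta> y)\<bar> \<le> dist (\<zeta> x) (\<zeta> y)"
      using abs_Re_le_cmod[of "\<zeta> x - \<zeta> y"] by (simp add: dist_norm)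
    then have "d / 2 * \<bar>Re (\<zeta> x) - Re (\<zeta> y)\<bar> \<le> d / 2 * (2 / d * dist x y)"
      unfolding dist_\<zeta> using d_pos by (intro mult_left_mono) auto
    moreover have e: "d / 2 * Re (\<zeta> x) - d / 2 * Re (\<zeta> y) = d / 2 * (Re (\<zeta> x) - Re (\<zeta> y))"
      by (simp only: right_diff_distrib)
    ultimately show "\<bar>d / 2 * Re (\<zeta> x) - d / 2 * Re (\<zeta> y)\<bar> \<le> dist x y"
      unfolding e abs_mult using d_pos by simp
  next
    show "{- (d / 2 * r)..d / 2 * r} \<subseteq> (\<lambda>z. d / 2 * Re (\<zeta> z)) ` {z \<in> frontier K. \<bar>Re (\<zeta> z)\<bar> \<le> r}"
    proof
      fix t assume t: "t \<in> {- (d / 2 * r)..d / 2 * r}"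
      define X where "X = 2 * t / d"
      have X: "\<bar>X\<bar> \<le> r" and tX: "t = d / 2 * X"
        using t d_pos by (auto simp: X_def abs_le_iff field_simps)
      \<comment> \<open>The chord point with coordinate \<open>X\<close>; moving along
        \<open>\<i> * (b - a)\<close> changes only the imaginary part of
        \<open>\<zeta>\<close>.\<close>
      define z0 where "z0 = (1 - (1 + X) / 2) *\<^sub>R a + ((1 + X) / 2) *\<^sub>R b"
      have "z0 \<in> K" unfolding z0_def
        by (rule convexD_alt[OF convex a b]) (use X assms in auto)
      moreover have "\<i> * (b - a) \<noteq> 0" using b_neq_a by simp
      ultimately obtain s where s: "z0 + s *\<^sub>R (\<i> * (b - a)) \<in> frontier K"
        using compact_line_meets_frontier[OF compact] by blast
      have "\<zeta> (z0 + s *\<^sub>R (\<i> * (b - a))) = of_real X + 2 * of_real s * \<i>"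
        using b_neq_a by (simp add: \<zeta>_def z0_def scaleR_conv_of_real field_simps)
      then have "Re (\<zeta> (z0 + s *\<^sub>R (\<i> * (b - a)))) = X" by simp
      with s X tX show "t \<in> (\<lambda>z. d / 2 * Re (\<zeta> z)) ` {z \<in> frontier K. \<bar>Re (\<zeta> z)\<bar> \<le> r}"
        by (intro image_eqI[of _ _ "z0 + s *\<^sub>R (\<i> * (b - a))"]) auto
    qed
  qed
  then show ?thesis by simp
qed

definition chord_poly :: "nat \<Rightarrow> nat \<Rightarrow> complex poly" where
  "chord_poly k l = [:-a, 1:] ^ k * [:-b, 1:] ^ l"

lemma chord_poly_in: "chord_poly k l \<in> polys_zeros_in (k + l) K"
proof -
  have "degree (chord_poly k l) = k + l"
    unfolding chord_poly_def by (subst degree_mult_eq) (auto simp: degree_power_eq)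
  then show ?thesis
    using a b by (auto simp: polys_zeros_in_def chord_poly_def)
qed

lemma cmod_chord_poly: "cmod (poly (chord_poly k l) z) = (d / 2) ^ (k + l) * cmod (chord_val k l (\<zeta> z))"
proof -
  have "poly (chord_poly k l) z = (z - a) ^ k * (z - b) ^ l" by (simp add: chord_poly_def)
  also have "\<dots> = ((b - a) / 2) ^ (k + l) * chord_val k l (\<zeta> z)"
    unfolding minus_a[of z] minus_b[of z] chord_val_def by (simp only: power_mult_distrib power_add mult_ac)
  finally show ?thesis by (simp add: norm_mult norm_power norm_divide cmod_ba)
qed

lemma cmod_pderiv_chord_poly:
  "cmod (poly (pderiv (chord_poly k l)) z) = (d / 2) ^ (k + l - 1) * cmod (chord_deriv k l (\<zeta> z))"
proof -
  define h where "h = (b - a) / 2"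
  have "poly (pderiv (chord_poly k l)) z
      = of_nat k * (z - a) ^ (k - 1) * (z - b) ^ l + of_nat l * (z - a) ^ k * (z - b) ^ (l - 1)"
    by (simp add: chord_poly_def pderiv_mult pderiv_power pderiv_pCons algebra_simps)
  also have "\<dots> = (of_nat k * (h ^ (k - 1) * h ^ l)) * (\<zeta> z + 1) ^ (k - 1) * (\<zeta> z - 1) ^ l
      + (of_nat l * (h ^ k * h ^ (l - 1))) * (\<zeta> z + 1) ^ k * (\<zeta> z - 1) ^ (l - 1)"
    unfolding minus_a[of z] minus_b[of z] h_def[symmetric] by (simp only: power_mult_distrib mult_ac)
  \<comment> \<open>For \<open>k = 0\<close> the exponents differ, but both sides vanish.\<close>
  also have "of_nat k * (h ^ (k - 1) * h ^ l) = of_nat k * h ^ (k + l - 1)"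
    by (cases k) (auto simp: power_add)
  also have "of_nat l * (h ^ k * h ^ (l - 1)) = of_nat l * h ^ (k + l - 1)"
    by (cases l) (auto simp: power_add)
  finally have "poly (pderiv (chord_poly k l)) z = h ^ (k + l - 1) * chord_deriv k l (\<zeta> z)"
    by (simp add: chord_deriv_def algebra_simps)
  then show ?thesis by (simp add: h_def norm_mult norm_power norm_divide cmod_ba)
qed

end

subsection \<open>Norm estimates\<close>

lemma turan_const_real_tendsto: "(turan_const_real \<longlongrightarrow> 121) at_top"
  unfolding turan_const_real_def by real_asymp

lemma turan_const_infinity: "turan_const \<infinity> = 121"
  unfolding turan_const_def using tendsto_Lim[OF _ turan_const_real_tendsto] by simp

text \<open>The square root is at least \<open>q\<close> and at least 1: the former makes the
  fraction at least 1, the latter makes the base of the power at least 5.\<close>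

lemma turan_const_real_ge:
  assumes "0 < q"
  shows "121 * 5 powr (1 / q) \<le> turan_const_real q"
proof -
  have s: "q \<le> sqrt (q\<^sup>2 + 3 * q + 1)" "1 \<le> sqrt (q\<^sup>2 + 3 * q + 1)"
    using assms by (auto intro: real_le_rsqrt)
  define A where "A = (3 * q + 2 + 2 * sqrt (q\<^sup>2 + 3 * q + 1)) / (5 * q)"
  have "5 * q \<le> 3 * q + 2 + 2 * sqrt (q\<^sup>2 + 3 * q + 1)" using s by linarith
  then have "1 \<le> A"
    using assms by (simp add: A_def le_divide_eq_1)
  moreover have "5 powr (1 / q) \<le> (3 + 2 * q + 2 * sqrt (q\<^sup>2 + 3 * q + 1)) powr (1 / q)"
  proof (rule powr_mono2)
    show "5 \<le> 3 + 2 * q + 2 * sqrt (q\<^sup>2 + 3 * q + 1)" using s assms by linarith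
  qed (use assms in auto)
  ultimately have "(121 * 1) * 5 powr (1 / q) \<le> turan_const_real q"
    unfolding turan_const_real_def A_def[symmetric] by (intro mult_mono mult_left_mono) auto
  then show ?thesis by simp
qed

section \<open>From pointwise bounds to norms\<close>

text \<open>Off \<open>T\<close> the pointwise bound contributes once the integral of
  \<open>(c g)^q\<close>. On \<open>T\<close> the contribution is at most \<open>(c m)^q\<close>
  times \<open>v powr q * measure \<mu> T\<close>; \<open>TS\<close> and \<open>g \<ge> m\<close> on
  \<open>S\<close> bound this by four times that integral.\<close>

lemma set_integral_powr_le:
  fixes f g :: "complex \<Rightarrow> real"
  assumes "0 < q" and "finite_measure \<mu>" and sets[measurable_cong]: "sets \<mu> = sets borel"
    and K: "compact K" and F: "AE z in \<mu>. z \<in> F" "F \<subseteq> K"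
    and f: "continuous_on UNIV f" "\<And>z. 0 \<le> f z" and g: "continuous_on UNIV g" "\<And>z. 0 \<le> g z"
    and T[measurable]: "T \<in> sets borel" and S[measurable]: "S \<in> sets borel" and "S \<subseteq> F"
    and nonneg: "0 \<le> c" "0 \<le> m" "0 \<le> v"
    and near: "\<And>z. z \<in> F \<Longrightarrow> z \<notin> T \<Longrightarrow> f z \<le> c * g z"
    and far: "\<And>z. z \<in> F \<Longrightarrow> z \<in> T \<Longrightarrow> f z \<le> c * (v * m)"
    and ref: "\<And>z. z \<in> S \<Longrightarrow> m \<le> g z"
    and TS: "v powr q * measure \<mu> T \<le> 4 * measure \<mu> S"
  shows "(LINT z:K|\<mu>. f z powr q) \<le> 5 * c powr q * (LINT z:K|\<mu>. g z powr q)"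
    and "m powr q * measure \<mu> S \<le> (LINT z:K|\<mu>. g z powr q)"
proof -
  interpret finite_measure \<mu> by fact
  have [measurable]: "K \<in> sets borel" using K by (simp add: compact_imp_closed)
  have int: "integrable \<mu> (\<lambda>z. indicator K z * h z powr q)"
    if h: "continuous_on UNIV h" "\<And>z. 0 \<le> h z" for h :: "complex \<Rightarrow> real"
  proof -
    have c: "continuous_on UNIV (\<lambda>z. h z powr q)"
      using h \<open>0 < q\<close> by (intro continuous_on_powr') (auto intro: continuous_intros)
    then have [measurable]: "(\<lambda>z. h z powr q) \<in> borel_measurable borel"
      by (rule borel_measurable_continuous_onI)
    have "compact ((\<lambda>z. h z powr q) ` K)"
      using K c by (intro compact_continuous_image) (auto intro: continuous_on_subset)
    from compact_imp_bounded[OF this] obtain B where B: "\<And>z. z \<in> K \<Longrightarrow> norm (h z powr q) \<le> B"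
      unfolding bounded_iff by blast
    show ?thesis
      by (rule integrable_const_bound[of _ "max B 0"])
        (auto simp: indicator_def intro!: AE_I2 dest: B)
  qed
  note int_f = int[OF f] and int_g = int[OF g]
  have int_T: "integrable \<mu> (indicator T :: _ \<Rightarrow> real)" and int_S: "integrable \<mu> (indicator S :: _ \<Rightarrow> real)"
    using emeasure_finite by (simp_all add: sets less_top[symmetric])
  have "(\<integral>z. m powr q * indicator S z \<partial>\<mu>) \<le> (\<integral>z. indicator K z * g z powr q \<partial>\<mu>)"
  proof (rule integral_mono)
    fix z
    show "m powr q * indicator S z \<le> indicator K z * g z powr q"
      using ref[of z] \<open>S \<subseteq> F\<close> F(2) \<open>0 \<le> m\<close> \<open>0 < q\<close>
      by (auto simp: indicator_def intro: powr_mono2)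
  qed (use int_S int_g in auto)
  then show mS: "m powr q * measure \<mu> S \<le> (LINT z:K|\<mu>. g z powr q)"
    by (simp add: set_lebesgue_integral_def sets)
  have "(\<integral>z. indicator K z * f z powr q \<partial>\<mu>)
      \<le> (\<integral>z. c powr q * (indicator K z * g z powr q) + c powr q * (v powr q * m powr q) * indicator T z \<partial>\<mu>)"
  proof (rule integral_mono_AE)
    show "AE z in \<mu>. indicator K z * f z powr q
        \<le> c powr q * (indicator K z * g z powr q) + c powr q * (v powr q * m powr q) * indicator T z"
      using F(1)
    proof eventually_elim
      case (elim z)
      then have "z \<in> K" using F by auto
      show ?case
      proof (cases "z \<in> T")
        case True
        have "f z powr q \<le> (c * (v * m)) powr q"
          using far[OF elim True] f \<open>0 < q\<close> by (intro powr_mono2) auto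
        also have "\<dots> = c powr q * (v powr q * m powr q)" using nonneg by (simp add: powr_mult)
        finally show ?thesis using True \<open>z \<in> K\<close> by (simp add: add_increasing)
      next
        case False
        have "f z powr q \<le> (c * g z) powr q"
          using near[OF elim False] f \<open>0 < q\<close> by (intro powr_mono2) auto
        also have "\<dots> = c powr q * g z powr q" using nonneg g by (simp add: powr_mult)
        finally show ?thesis using False \<open>z \<in> K\<close> by simp
      qed
    qed
  qed (use int_f int_g int_T in auto)
  also have "\<dots> = c powr q * (LINT z:K|\<mu>. g z powr q) + c powr q * m powr q * (v powr q * measure \<mu> T)"
    using int_g int_T by (simp add: set_lebesgue_integral_def sets)
  also have "\<dots> \<le> c powr q * (LINT z:K|\<mu>. g z powr q) + c powr q * m powr q * (4 * measure \<mu> S)"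
    using TS by (intro add_left_mono mult_left_mono) auto
  also have "\<dots> = c powr q * (LINT z:K|\<mu>. g z powr q) + 4 * c powr q * (m powr q * measure \<mu> S)"
    by simp
  also have "\<dots> \<le> c powr q * (LINT z:K|\<mu>. g z powr q) + 4 * c powr q * (LINT z:K|\<mu>. g z powr q)"
    using mS by (intro add_left_mono mult_left_mono) auto
  finally show "(LINT z:K|\<mu>. f z powr q) \<le> 5 * c powr q * (LINT z:K|\<mu>. g z powr q)"
    by (simp add: set_lebesgue_integral_def)
qed

lemma measure_support_subset:
  assumes "closed F" "emeasure \<mu> (- F) = 0"
  shows "measure_support \<mu> \<subseteq> F"
  using assms by (force simp: measure_support_def)

text \<open>Otherwise finitely many open null sets would cover the compact set
  \<open>S\<close>.\<close>

lemma measure_support_meets: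
  assumes sets: "sets \<mu> = sets borel" and "compact S" "emeasure \<mu> S \<noteq> 0"
  obtains z where "z \<in> S" "z \<in> measure_support \<mu>"
proof (rule ccontr)
  assume "\<not> thesis"
  with that have "\<forall>z\<in>S. \<exists>U. open U \<and> z \<in> U \<and> emeasure \<mu> U = 0"
    unfolding measure_support_def by (auto simp: zero_less_iff_neq_zero)
  then obtain U where U: "\<And>z. z \<in> S \<Longrightarrow> open (U z) \<and> z \<in> U z \<and> emeasure \<mu> (U z) = 0" by metis
  obtain D where D: "D \<subseteq> S" "finite D" "S \<subseteq> (\<Union>z\<in>D. U z)"
    using compactE_image[OF \<open>compact S\<close>, of S U] U by blast
  have "emeasure \<mu> S \<le> emeasure \<mu> (\<Union>z\<in>D. U z)"
    using D U by (intro emeasure_mono D(3)) (auto simp: sets intro!: borel_open open_UN)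
  also have "\<dots> \<le> (\<Sum>z\<in>D. emeasure \<mu> (U z))"
    using D U by (intro emeasure_subadditive_finite) (auto simp: sets)
  also have "\<dots> = 0" using D U by (intro sum.neutral) auto
  finally show False using assms by simp
qed

text \<open>For finite \<open>q\<close> the factor 5 of the integral estimate becomes
  \<open>5 powr (1 / q)\<close>, which the constant absorbs. For \<open>q = \<infinity>\<close> the
  support meets \<open>S\<close>, so \<open>m\<close> is at most the norm of \<open>p\<close>, and
  \<open>v \<le> 1\<close> makes the bound on \<open>T\<close> as good as the one off
  \<open>T\<close>.\<close>

lemma poly_norm_quotient_le:
  fixes p :: "complex poly"
  assumes "0 < q" and fin: "finite_measure \<mu>" and sets: "sets \<mu> = sets borel"
    and K: "compact K" and F: "closed F" "emeasure \<mu> (- F) = 0" "F \<subseteq> K"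
    and T: "T \<in> sets borel" and S: "compact S" "S \<subseteq> F" "0 < measure \<mu> S"
    and nonneg: "0 \<le> c" "0 < m" "0 \<le> v"
    and near: "\<And>z. z \<in> F \<Longrightarrow> z \<notin> T \<Longrightarrow> cmod (poly (pderiv p) z) \<le> 121 * c * cmod (poly p z)"
    and far: "\<And>z. z \<in> F \<Longrightarrow> z \<in> T \<Longrightarrow> cmod (poly (pderiv p) z) \<le> 121 * c * (v * m)"
    and ref: "\<And>z. z \<in> S \<Longrightarrow> m \<le> cmod (poly p z)"
    and top: "q = \<infinity> \<Longrightarrow> v \<le> 1"
    and TS: "q \<noteq> \<infinity> \<Longrightarrow> v powr enn2real q * measure \<mu> T \<le> 4 * measure \<mu> S"
  shows "0 < poly_norm q K \<mu> p"
    and "poly_norm q K \<mu> (pderiv p) \<le> turan_const q * c * poly_norm q K \<mu> p"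
proof -
  interpret finite_measure \<mu> by fact
  have cont: "continuous_on A (\<lambda>z. cmod (poly r z))" for r and A :: "complex set"
    by (intro continuous_intros)
  have "compact F" using K F by (metis closed_Int_compact inf.absorb1)
  have "0 < poly_norm q K \<mu> p \<and> poly_norm q K \<mu> (pderiv p) \<le> turan_const q * c * poly_norm q K \<mu> p"
  proof (cases "q = \<infinity>")
    case True
    let ?Z = "measure_support \<mu>"
    have "?Z \<subseteq> F" by (rule measure_support_subset[OF F(1,2)])
    have "emeasure \<mu> S \<noteq> 0" using S(3) by (auto simp: measure_def)
    then obtain z0 where z0: "z0 \<in> S" "z0 \<in> ?Z" using measure_support_meets[OF sets S(1)] by blast
    have "bounded ((\<lambda>z. cmod (poly p z)) ` F)"
      by (intro compact_imp_bounded compact_continuous_image cont \<open>compact F\<close>)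
    then have bdd: "bdd_above ((\<lambda>z. cmod (poly p z)) ` ?Z)"
      using \<open>?Z \<subseteq> F\<close> by (meson bdd_above_mono bounded_imp_bdd_above image_mono)
    define N where "N = (SUP z\<in>?Z. cmod (poly p z))"
    have le: "cmod (poly p z) \<le> N" if "z \<in> ?Z" for z
      unfolding N_def by (rule cSUP_upper[OF that bdd])
    have "m \<le> N" using ref[OF z0(1)] le[OF z0(2)] by simp
    have "(SUP z\<in>?Z. cmod (poly (pderiv p) z)) \<le> 121 * c * N"
    proof (rule cSUP_least)
      show "?Z \<noteq> {}" using z0 by auto
      fix z assume z: "z \<in> ?Z"
      then have "z \<in> F" using \<open>?Z \<subseteq> F\<close> by auto
      show "cmod (poly (pderiv p) z) \<le> 121 * c * N"
      proof (cases "z \<in> T")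
        case True
        have "v * m \<le> 1 * N" using top[OF \<open>q = \<infinity>\<close>] \<open>m \<le> N\<close> nonneg by (intro mult_mono) auto
        then have "121 * c * (v * m) \<le> 121 * c * N" using nonneg by (intro mult_left_mono) auto
        then show ?thesis using far[OF \<open>z \<in> F\<close> True] by simp
      next
        case False
        have "121 * c * cmod (poly p z) \<le> 121 * c * N"
          using nonneg le[OF z] by (intro mult_left_mono) auto
        then show ?thesis using near[OF \<open>z \<in> F\<close> False] by simp
      qed
    qed
    then show ?thesis
      using \<open>m \<le> N\<close> nonneg unfolding True turan_const_infinity by (simp add: poly_norm_def N_def)
  next
    case False
    define r where "r = enn2real q"
    have "0 < r" using \<open>0 < q\<close> False by (simp add: r_def enn2real_positive_iff less_top)
    have AE: "AE z in \<mu>. z \<in> F"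
      using F by (intro AE_I[of _ _ "- F"]) (auto simp: sets)
    have Sb: "S \<in> sets borel" using S(1) by (simp add: compact_imp_closed)
    define I where "I = (LINT z:K|\<mu>. cmod (poly p z) powr r)"
    have "0 \<le> 121 * c" "0 \<le> m" using nonneg by auto
    note main = set_integral_powr_le[OF \<open>0 < r\<close> fin sets K AE F(3) cont norm_ge_zero cont norm_ge_zero T Sb S(2)
        \<open>0 \<le> 121 * c\<close> \<open>0 \<le> m\<close> nonneg(3) near far ref TS[OF False, folded r_def], folded I_def]
    have "0 < m powr r * measure \<mu> S" using S(3) nonneg by simp
    with main(2) have "0 < I" by linarith
    have "poly_norm q K \<mu> (pderiv p) = (LINT z:K|\<mu>. cmod (poly (pderiv p) z) powr r) powr (1 / r)"
      using False by (simp add: poly_norm_def r_def)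
    also have "\<dots> \<le> (5 * (121 * c) powr r * I) powr (1 / r)"
      using \<open>0 < r\<close> by (intro powr_mono2 main(1))
        (auto simp: set_lebesgue_integral_def intro!: integral_nonneg)
    also have "\<dots> = 5 powr (1 / r) * (121 * c) * I powr (1 / r)"
      using \<open>0 < r\<close> nonneg \<open>0 < I\<close> by (simp add: powr_mult powr_powr)
    also have "\<dots> = (121 * 5 powr (1 / r)) * (c * I powr (1 / r))" by simp
    also have "\<dots> \<le> turan_const_real r * (c * I powr (1 / r))"
      using nonneg by (intro mult_right_mono turan_const_real_ge[OF \<open>0 < r\<close>]) auto
    finally show ?thesis
      using False \<open>0 < I\<close> by (simp add: poly_norm_def I_def r_def turan_const_def)
  qed
  then show "0 < poly_norm q K \<mu> p"
    and "poly_norm q K \<mu> (pderiv p) \<le> turan_const q * c * poly_norm q K \<mu> p" by auto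
qed

section \<open>Arc length on the boundary: the flat and the round case\<close>

context diametral_chord
begin

text \<open>The derivative carries one power of \<open>d / 2\<close> less than the polynomial, and
  \<open>n W / 4\<close> divided by \<open>d / 2\<close> is \<open>n w / d\<^sup>2\<close>, where
  \<open>n = k + l\<close> and \<open>W = 2 w / d\<close>.\<close>

lemma cmod_pderiv_chord_poly_le:
  assumes "0 < k + l" and "cmod (chord_deriv k l (\<zeta> z)) \<le> 121 * (real (k + l) * (2 * w / d) / 4) * x"
  shows "cmod (poly (pderiv (chord_poly k l)) z)
    \<le> 121 * (real (k + l) * w / d\<^sup>2) * ((d / 2) ^ (k + l) * x)"
proof -
  have e: "(d / 2) ^ (k + l) = d / 2 * (d / 2) ^ (k + l - 1)"
    using assms(1) by (metis Suc_diff_1 power_Suc)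
  have "cmod (poly (pderiv (chord_poly k l)) z)
      \<le> (d / 2) ^ (k + l - 1) * (121 * (real (k + l) * (2 * w / d) / 4) * x)"
    unfolding cmod_pderiv_chord_poly using d_pos assms(2) by (intro mult_left_mono) auto
  also have "(d / 2) ^ (k + l - 1) * (121 * (real (k + l) * (2 * w / d) / 4) * x)
      = 121 * (real (k + l) * w / d\<^sup>2) * ((d / 2) ^ (k + l) * x)"
    unfolding e using d_pos by (simp add: power2_eq_square field_simps)
  finally show ?thesis .
qed

abbreviation \<mu> :: "complex measure" where "\<mu> \<equiv> linear_measure_on (frontier K)"

lemma frontier_subset: "frontier K \<subseteq> K"
  by (simp add: compact compact_imp_closed frontier_subset_closed)

lemma emeasure_\<mu>: "A \<in> sets borel \<Longrightarrow> emeasure \<mu> A = linear_outer_measure (A \<inter> frontier K)"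
  by (rule emeasure_linear_measure_on) simp

lemma measure_\<mu>_le:
  assumes "A \<in> sets borel" "linear_outer_measure (A \<inter> frontier K) \<le> ennreal x" "0 \<le> x"
  shows "measure \<mu> A \<le> x"
  using assms by (simp add: measure_def emeasure_\<mu> enn2real_leI)

lemma emeasure_\<mu>_UNIV: "emeasure \<mu> UNIV \<le> ennreal (4 * d)"
  using linear_outer_measure_frontier_le_diameter[OF compact convex K_nonempty]
  by (simp add: emeasure_\<mu> d)

lemma finite_measure_\<mu>: "finite_measure \<mu>"
  using emeasure_\<mu>_UNIV by (intro finite_measureI) (auto simp: top_unique)

lemma measure_strip_ge:
  assumes "0 \<le> r" "r \<le> 1"
  shows "d * r \<le> measure \<mu> {z \<in> frontier K. \<bar>Re (\<zeta> z)\<bar> \<le> r}"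
    and "compact {z \<in> frontier K. \<bar>Re (\<zeta> z)\<bar> \<le> r}"
proof -
  interpret finite_measure \<mu> by (rule finite_measure_\<mu>)
  have "{z \<in> frontier K. \<bar>Re (\<zeta> z)\<bar> \<le> r} = frontier K \<inter> {z. \<bar>Re (\<zeta> z)\<bar> \<le> r}" by auto
  moreover have "closed {z. \<bar>Re (\<zeta> z)\<bar> \<le> r}"
    by (intro closed_Collect_le continuous_intros)
  ultimately show cS: "compact {z \<in> frontier K. \<bar>Re (\<zeta> z)\<bar> \<le> r}"
    using compact by (simp add: compact_frontier compact_Int_closed)
  then have "ennreal (d * r) \<le> emeasure \<mu> {z \<in> frontier K. \<bar>Re (\<zeta> z)\<bar> \<le> r}"
    using linear_outer_measure_strip_ge[OF assms]
    by (subst emeasure_\<mu>) (auto simp: compact_imp_closed Int_absorb2 intro: order.trans)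
  then show "d * r \<le> measure \<mu> {z \<in> frontier K. \<bar>Re (\<zeta> z)\<bar> \<le> r}"
    by (simp add: emeasure_eq_measure)
qed

text \<open>Flat case: the two vertical strips far from the centre of the chord carry at most the whole
  length \<open>4 d\<close>, but there the polynomial has decayed by a power of \<open>w / d\<close>.\<close>
lemma poly_norm_flat:
  fixes q :: ennreal
  assumes kl: "k \<le> l" "l \<le> k + 1" and "0 < q" and flat: "8 * w \<le> d"
    and n: "2 * (1 + enn2real (1 / q)) * (d\<^sup>2 / w\<^sup>2) * ln (d / w) \<le> real (k + l)"
  shows "0 < poly_norm q K \<mu> (chord_poly k l)"
    and "poly_norm q K \<mu> (pderiv (chord_poly k l))
      \<le> turan_const q * (real (k + l) * w / d\<^sup>2) * poly_norm q K \<mu> (chord_poly k l)"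
proof -
  define W where "W = 2 * w / d"
  have W: "0 < W" "W \<le> 1 / 4" using w_pos d_pos flat by (auto simp: W_def field_simps)
  have wd: "w / d = W / 2" "d / w = 2 / W" using w_pos d_pos by (auto simp: W_def)
  \<comment> \<open>For \<open>q = \<infinity>\<close> this is 0, and the damping factor
    \<open>(w / d) powr \<alpha>\<close> is 1.\<close>
  define \<alpha> where "\<alpha> = enn2real (1 / q)"
  have "0 \<le> \<alpha>" by (simp add: \<alpha>_def)
  have "d\<^sup>2 / w\<^sup>2 = 4 / W\<^sup>2" using w_pos d_pos by (simp add: W_def power_divide power_mult_distrib)
  then have "2 * (1 + \<alpha>) * (4 / W\<^sup>2) * ln (2 / W) \<le> real (k + l)"
    using n by (simp add: \<alpha>_def wd)
  then have nW: "8 * (1 + \<alpha>) * ln (2 / W) \<le> real (k + l) * W\<^sup>2"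
    using W by (simp add: field_simps)
  \<comment> \<open>The ratio \<open>d / w\<close> is at least 8, hence above \<open>exp 1\<close>.
    The degree hypothesis then gives \<open>(k + l) W\<^sup>2 \<ge> 8\<close>, from which
    \<open>(k + l) W \<ge> 1\<close> and \<open>k \<ge> 1\<close> follow.\<close>
  have "1 \<le> ln (2 / W)"
  proof -
    have "exp 1 * W \<le> 3 * (1 / 4)" using exp_le W by (intro mult_mono) auto
    then have "exp 1 \<le> 2 / W" using W by (simp add: pos_le_divide_eq)
    then show ?thesis using W by (simp add: ln_ge_iff)
  qed
  then have "8 * 1 * 1 \<le> 8 * (1 + \<alpha>) * ln (2 / W)"
    using \<open>0 \<le> \<alpha>\<close> by (intro mult_mono) auto
  then have "8 \<le> real (k + l) * W\<^sup>2" using nW by simp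
  also have "\<dots> \<le> real (k + l) * W" using W by (intro mult_left_mono) (auto simp: power2_eq_square mult_le_one)
  finally have n1: "1 \<le> real (k + l) * W" and n8: "8 \<le> real (k + l) * W" by auto
  have "real (k + l) * W \<le> real (k + l) * 1" using W by (intro mult_left_mono) auto
  with n8 have "8 \<le> k + l" by simp
  then have k: "1 \<le> k" "0 < k + l" using kl by auto
  define T where "T = {z. 12 * W\<^sup>2 < (Re (\<zeta> z))\<^sup>2}"
  \<comment> \<open>The half-width \<open>W / 2 = w / d\<close> gives this strip length at least
    \<open>w\<close>. In \<open>m\<close> the factor 7 / 8 bounds the possible extra factor
    \<open>1 - W / 2\<close> from below.\<close>
  define S where "S = {z \<in> frontier K. \<bar>Re (\<zeta> z)\<bar> \<le> W / 2}"
  define m where "m = (1 - (W / 2)\<^sup>2) ^ k * (7 / 8)"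
  have "(W / 2)\<^sup>2 \<le> (1 / 8)\<^sup>2" using W by (intro power_mono) auto
  then have W2: "(W / 2)\<^sup>2 < 1" by (simp add: power2_eq_square)
  then have "0 < m" by (simp add: m_def)
  have T: "T \<in> sets borel"
    unfolding T_def by (intro borel_open open_Collect_less continuous_intros)
  have S: "compact S" "d * (W / 2) \<le> measure \<mu> S"
    unfolding S_def using measure_strip_ge[of "W / 2"] W by auto
  have "w \<le> measure \<mu> S" using S(2) d_pos by (simp add: W_def)
  have near: "cmod (poly (pderiv (chord_poly k l)) z)
      \<le> 121 * (real (k + l) * w / d\<^sup>2) * cmod (poly (chord_poly k l) z)"
    if z: "z \<in> frontier K" "z \<notin> T" for z
  proof -
    have "(Im (\<zeta> z))\<^sup>2 \<le> 3 * W\<^sup>2" unfolding W_def using Im_\<zeta>_le z frontier_subset by auto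
    then have "cmod (chord_deriv k l (\<zeta> z)) \<le> 121 * (real (k + l) * W / 4) * cmod (chord_val k l (\<zeta> z))"
      using z(2) by (intro cmod_chord_deriv_flat_near kl W n1) (auto simp: T_def)
    from cmod_pderiv_chord_poly_le[OF k(2) this[unfolded W_def]] show ?thesis
      by (simp only: cmod_chord_poly)
  qed
  have far: "cmod (poly (pderiv (chord_poly k l)) z)
      \<le> 121 * (real (k + l) * w / d\<^sup>2) * ((w / d) powr \<alpha> * ((d / 2) ^ (k + l) * m))"
    if z: "z \<in> frontier K" "z \<in> T" for z
  proof -
    have "z \<in> K" using z frontier_subset by auto
    then have "(Im (\<zeta> z))\<^sup>2 \<le> 3 * W\<^sup>2" unfolding W_def by (rule Im_\<zeta>_le)
    then have "cmod (chord_deriv k l (\<zeta> z)) \<le> 4 * real (k + l) * (1 - 6/5 * W\<^sup>2) ^ (k - 1)"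
      using z(2) by (intro cmod_chord_deriv_flat_far k kl W cmod_\<zeta>_le \<zeta>_lens \<open>z \<in> K\<close>) (auto simp: T_def)
    also have "\<dots> \<le> 121 * (real (k + l) * W / 4) * ((w / d) powr \<alpha> * m)"
      unfolding wd m_def by (rule flat_far_decay[OF k(1) kl W(2,1) \<open>0 \<le> \<alpha>\<close> nW])
    finally have "cmod (chord_deriv k l (\<zeta> z)) \<le> 121 * (real (k + l) * (2 * w / d) / 4) * ((w / d) powr \<alpha> * m)"
      by (simp only: W_def)
    from cmod_pderiv_chord_poly_le[OF k(2) this] show ?thesis by (simp only: mult_ac)
  qed
  have ref: "(d / 2) ^ (k + l) * m \<le> cmod (poly (chord_poly k l) z)" if "z \<in> S" for z
  proof -
    have "(7 / 8) \<le> (1 - W / 2) ^ (l - k)"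
    proof -
      have "l - k = 0 \<or> l - k = 1" using kl by auto
      then show ?thesis using W by auto
    qed
    then have "m \<le> (1 - (W / 2)\<^sup>2) ^ k * (1 - W / 2) ^ (l - k)"
      unfolding m_def using W2 by (intro mult_left_mono) auto
    also have "\<dots> \<le> cmod (chord_val k l (\<zeta> z))"
      using that W by (intro cmod_chord_val_ge kl) (auto simp: S_def)
    finally show ?thesis unfolding cmod_chord_poly using d_pos by (intro mult_left_mono) auto
  qed
  \<comment> \<open>As \<open>\<alpha>\<close> is the reciprocal of \<open>q\<close>, the damping to
    the power \<open>q\<close> is exactly \<open>w / d\<close>, which turns the total length
    \<open>4 d\<close> into \<open>4 w\<close>.\<close>
  have TS: "((w / d) powr \<alpha>) powr enn2real q * measure \<mu> T \<le> 4 * measure \<mu> S" if "q \<noteq> \<infinity>"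
  proof -
    have "\<alpha> * enn2real q = 1"
    proof (cases q)
      case (real r)
      then have "0 < r" using \<open>0 < q\<close> by simp
      then have "1 / q = ennreal (1 / r)"
        using real by (metis divide_ennreal ennreal_1 zero_le_one)
      then show ?thesis using real \<open>0 < r\<close> by (simp add: \<alpha>_def)
    qed (use that in simp)
    then have "((w / d) powr \<alpha>) powr enn2real q = w / d"
      using w_pos d_pos by (simp add: powr_powr)
    moreover have "measure \<mu> T \<le> 4 * d"
    proof (rule measure_\<mu>_le[OF T])
      show "linear_outer_measure (T \<inter> frontier K) \<le> ennreal (4 * d)"
        using linear_outer_measure_mono[of "T \<inter> frontier K" "frontier K"] emeasure_\<mu>_UNIV
        by (simp add: emeasure_\<mu> order.trans)
    qed (use d_pos in simp)
    then have "w / d * measure \<mu> T \<le> w / d * (4 * d)"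
      using w_pos d_pos by (intro mult_left_mono) auto
    ultimately show ?thesis using \<open>w \<le> measure \<mu> S\<close> d_pos by simp
  qed
  have v: "(w / d) powr \<alpha> \<le> 1" using w_pos d_pos w_le_d \<open>0 \<le> \<alpha>\<close> by (intro powr_le1) auto
  have null: "emeasure \<mu> (- frontier K) = 0"
    by (subst emeasure_\<mu>) (auto simp: linear_outer_measure_empty)
  have pos: "0 \<le> real (k + l) * w / d\<^sup>2" "0 < (d / 2) ^ (k + l) * m" "0 < measure \<mu> S"
    using w_pos d_pos \<open>0 < m\<close> \<open>w \<le> measure \<mu> S\<close> by auto
  have SF: "S \<subseteq> frontier K" by (auto simp: S_def)
  note main = poly_norm_quotient_le[OF \<open>0 < q\<close> finite_measure_\<mu> sets_linear_measure_on compact frontier_closed null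
      frontier_subset T S(1) SF pos(3,1,2) powr_ge_zero near far ref v TS]
  show "0 < poly_norm q K \<mu> (chord_poly k l)" by (rule main(1))
  show "poly_norm q K \<mu> (pderiv (chord_poly k l))
      \<le> turan_const q * (real (k + l) * w / d\<^sup>2) * poly_norm q K \<mu> (chord_poly k l)" by (rule main(2))
qed

text \<open>Round case: only neighbourhoods of the two zeros are exceptional, and they carry little
  length.\<close>
lemma poly_norm_round:
  fixes q :: ennreal
  assumes kl: "k \<le> l" "l \<le> k + 1" "1 \<le> l" and "0 < q" and round: "d \<le> 8 * w"
  shows "0 < poly_norm q K \<mu> (chord_poly k l)"
    and "poly_norm q K \<mu> (pderiv (chord_poly k l))
      \<le> turan_const q * (real (k + l) * w / d\<^sup>2) * poly_norm q K \<mu> (chord_poly k l)"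
proof -
  define W where "W = 2 * w / d"
  have W: "1 / 4 \<le> W" using w_pos d_pos round by (simp add: W_def field_simps)
  have n: "0 < k + l" using kl by simp
  \<comment> \<open>\<open>W \<ge> 1 / 4\<close> makes \<open>121 W / 4\<close> at least 121 / 16,
    which exceeds both the 15 / 2 of \<open>round_far_decay\<close> and the 7 of the bound away from
    the zeros.\<close>
  have c: "15 / 2 * real (k + l) \<le> 121 * (real (k + l) * W / 4)"
  proof -
    have "15 / 2 * real (k + l) \<le> 121 * (real (k + l) * (1 / 4) / 4)" by simp
    also have "\<dots> \<le> 121 * (real (k + l) * W / 4)"
      using W by (intro mult_left_mono divide_right_mono) auto
    finally show ?thesis .
  qed
  define T where "T = {z. cmod (\<zeta> z + 1) \<le> 1 / 7} \<union> {z. cmod (\<zeta> z - 1) \<le> 1 / 7}"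
  define S where "S = {z \<in> frontier K. \<bar>Re (\<zeta> z)\<bar> \<le> 1 / 3}"
  define m where "m = (1 - (1 / 3)\<^sup>2) ^ k * (1 - 1 / 3 :: real) ^ (l - k)"
  have "0 < m" by (simp add: m_def power2_eq_square)
  have T: "T \<in> sets borel"
    unfolding T_def by (intro sets.Un borel_closed closed_Collect_le continuous_intros)
  have S: "compact S" "d * (1 / 3) \<le> measure \<mu> S"
    unfolding S_def using measure_strip_ge[of "1 / 3"] by auto
  have near: "cmod (poly (pderiv (chord_poly k l)) z)
      \<le> 121 * (real (k + l) * w / d\<^sup>2) * cmod (poly (chord_poly k l) z)"
    if z: "z \<in> frontier K" "z \<notin> T" for z
  proof -
    have "cmod (chord_deriv k l (\<zeta> z)) \<le> 7 * real (k + l) * cmod (chord_val k l (\<zeta> z))"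
      using z(2) by (intro cmod_chord_deriv_round_near) (auto simp: T_def)
    also have "\<dots> \<le> 121 * (real (k + l) * W / 4) * cmod (chord_val k l (\<zeta> z))"
      using c by (intro mult_right_mono) auto
    finally have "cmod (chord_deriv k l (\<zeta> z)) \<le> 121 * (real (k + l) * (2 * w / d) / 4) * cmod (chord_val k l (\<zeta> z))"
      by (simp only: W_def)
    from cmod_pderiv_chord_poly_le[OF n this] show ?thesis by (simp only: cmod_chord_poly)
  qed
  have far: "cmod (poly (pderiv (chord_poly k l)) z)
      \<le> 121 * (real (k + l) * w / d\<^sup>2) * (1 * ((d / 2) ^ (k + l) * m))"
    if z: "z \<in> frontier K" "z \<in> T" for z
  proof -
    have "z \<in> K" using z frontier_subset by auto
    have "cmod (chord_deriv k l (\<zeta> z)) \<le> real (k + l) * (2 ^ l * (1 / 7) ^ (k - 1))"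
      using z(2) by (intro cmod_chord_deriv_round_far kl cmod_\<zeta>_le \<open>z \<in> K\<close>) (auto simp: T_def)
    also have "\<dots> \<le> real (k + l) * (15 / 2 * m)"
      unfolding m_def by (intro mult_left_mono round_far_decay kl) auto
    also have "\<dots> = 15 / 2 * real (k + l) * m" by simp
    also have "\<dots> \<le> 121 * (real (k + l) * W / 4) * m"
      using c \<open>0 < m\<close> by (intro mult_right_mono) auto
    finally have "cmod (chord_deriv k l (\<zeta> z)) \<le> 121 * (real (k + l) * (2 * w / d) / 4) * m"
      by (simp only: W_def)
    from cmod_pderiv_chord_poly_le[OF n this] show ?thesis by simp
  qed
  have ref: "(d / 2) ^ (k + l) * m \<le> cmod (poly (chord_poly k l) z)" if "z \<in> S" for z
  proof -
    have "m \<le> cmod (chord_val k l (\<zeta> z))"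
      unfolding m_def using that by (intro cmod_chord_val_ge kl) (auto simp: S_def)
    then show ?thesis unfolding cmod_chord_poly using d_pos by (intro mult_left_mono) auto
  qed
  \<comment> \<open>Radius 1 / 7 in the coordinate \<open>\<zeta>\<close> is radius
    \<open>d / 14\<close> in the plane.\<close>
  have "measure \<mu> T \<le> 8 * d / 7"
  proof (rule measure_\<mu>_le[OF T])
    have "T \<inter> frontier K \<subseteq> (frontier K \<inter> cball a (d / 14)) \<union> (frontier K \<inter> cball b (d / 14))"
      unfolding T_def cmod_\<zeta>_plus cmod_\<zeta>_minus
      using d_pos by (auto simp: dist_commute field_simps)
    then have "linear_outer_measure (T \<inter> frontier K)
        \<le> linear_outer_measure (frontier K \<inter> cball a (d / 14)) + linear_outer_measure (frontier K \<inter> cball b (d / 14))"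
      by (rule order.trans[OF linear_outer_measure_mono linear_outer_measure_Un])
    also have "\<dots> \<le> ennreal (8 * (d / 14)) + ennreal (8 * (d / 14))"
      using d_pos by (intro add_mono linear_outer_measure_frontier_Int_cball_le compact convex a b) auto
    also have "\<dots> = ennreal (8 * d / 7)" using d_pos by (simp flip: ennreal_plus)
    finally show "linear_outer_measure (T \<inter> frontier K) \<le> ennreal (8 * d / 7)" .
  qed (use d_pos in simp)
  \<comment> \<open>8 / 7 is below 4 / 3, and \<open>S\<close> has length at least
    \<open>d / 3\<close>.\<close>
  then have TS: "1 powr enn2real q * measure \<mu> T \<le> 4 * measure \<mu> S"
    using S(2) d_pos by simp
  have null: "emeasure \<mu> (- frontier K) = 0"
    by (subst emeasure_\<mu>) (auto simp: linear_outer_measure_empty)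
  have pos: "0 \<le> real (k + l) * w / d\<^sup>2" "0 < (d / 2) ^ (k + l) * m" "0 < measure \<mu> S"
    using w_pos d_pos \<open>0 < m\<close> S(2) by auto
  have SF: "S \<subseteq> frontier K" by (auto simp: S_def)
  note main = poly_norm_quotient_le[OF \<open>0 < q\<close> finite_measure_\<mu> sets_linear_measure_on compact frontier_closed null
      frontier_subset T S(1) SF pos(3,1,2) zero_le_one near far ref order.refl TS]
  show "0 < poly_norm q K \<mu> (chord_poly k l)" by (rule main(1))
  show "poly_norm q K \<mu> (pderiv (chord_poly k l))
      \<le> turan_const q * (real (k + l) * w / d\<^sup>2) * poly_norm q K \<mu> (chord_poly k l)" by (rule main(2))
qed

end

theorem corollary1:
  fixes K :: "complex set" and q :: ennreal and n :: nat and w d :: real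
    and \<mu> :: "complex measure"
  assumes "compact K" and "convex K" and "K \<noteq> {}"
    and "w = width K" and "d = diameter K" and "w > 0"
    and "q > 0" and "n > 0"
    and "real n \<ge> 2 * (1 + enn2real (1 / q)) * (d\<^sup>2 / w\<^sup>2) * ln (d / w)"
    and "\<mu> = linear_measure_on (frontier K)"
  shows "turan_inf n q K \<mu> \<le> ereal (turan_const q * (w / d\<^sup>2) * real n) \<and>
    (turan_const_real \<longlongrightarrow> 121) at_top \<and> turan_const \<infinity> = 121"
proof (intro conjI turan_const_real_tendsto turan_const_infinity)
  obtain a b where ab: "a \<in> K" "b \<in> K" "dist a b = d"
    using diameter_compact_attained[OF assms(1,3)] assms(5) by blast
  interpret diametral_chord K a b d w
    by unfold_locales (use assms ab in auto)
  \<comment> \<open>The degree is split as evenly as possible; the odd factor goes to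
    \<open>b\<close>, so that \<open>l \<ge> 1\<close> even for \<open>n = 1\<close>.\<close>
  define k l where "k = n div 2" and "l = n - n div 2"
  have kl: "k \<le> l" "l \<le> k + 1" "1 \<le> l" and n: "n = k + l"
    using \<open>n > 0\<close> by (auto simp: k_def l_def)
  define p where "p = chord_poly k l"
  have p: "0 < poly_norm q K \<mu> p \<and>
      poly_norm q K \<mu> (pderiv p) \<le> turan_const q * (real n * w / d\<^sup>2) * poly_norm q K \<mu> p"
  proof (cases "8 * w \<le> d")
    case True
    show ?thesis
      unfolding p_def n \<open>\<mu> = _\<close> using poly_norm_flat[OF kl(1,2) \<open>q > 0\<close> True] assms(9) n by simp
  next
    case False
    then show ?thesis
      unfolding p_def n \<open>\<mu> = _\<close> using poly_norm_round[OF kl \<open>q > 0\<close>] by simp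
  qed
  then have "turan_inf n q K \<mu> \<le> ereal (poly_norm q K \<mu> (pderiv p) / poly_norm q K \<mu> p)"
    unfolding turan_inf_def using chord_poly_in[of k l] by (intro INF_lower) (auto simp: p_def n)
  also have "\<dots> \<le> ereal (turan_const q * (w / d\<^sup>2) * real n)"
    using p by (simp add: pos_divide_le_eq mult_ac)
  finally show "turan_inf n q K \<mu> \<le> ereal (turan_const q * (w / d\<^sup>2) * real n)" .
qed

end
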